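(* Let $n>1$ be a square-free integer, and let $F_n,C_n,D_n,g_n$ be as defined in the context. Let $U\subset\mathbb{C}$ be a simply connected domain containing the open unit disc and containing no zero of the polynomial $y\mapsto F_n(y^2)$; let $g_n$ also denote its analytic continuation to $U$, and let $\sqrt{F_n(y^2)}$ denote the analytic branch on $U$ of the square root whose value at $y=0$ is $1$. For $y\in U$ put $x=y^2$, $\sqrt{x}=y$, $\sqrt{nx}=\sqrt n\,y$ and $\sqrt{F_n(x)}=\sqrt{F_n(y^2)}$. Then the Aurifeuillian factors $F_n^{\pm}(x)=C_n(x)\pm\sqrt{nx}\,D_n(x)$ of $F_n(x)$ are given by $$F_n^{\pm}(x)=\sqrt{F_n(x)}\,\exp\left(\pm\sqrt{n}\,g_n(\sqrt{x})\right).$$ Also, $$C_n(x)=\sqrt{F_n(x)}\,\cosh\left(\sqrt n\,g_n(\sqrt x)\right)$$ and, for $x\neq0$, $$D_n(x)=\frac{\sqrt{F_n(x)}}{\sqrt{nx}}\,\sinh\left(\sqrt n\,g_n(\sqrt x)\right).$$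
   Context: $\Phi_m$ denotes the $m$-th cyclotomic polynomial and $\phi$ Euler's totient function. For square-free $n>1$ let $s=-1$ if $n\equiv 3\pmod 4$ and $s=+1$ otherwise, and define $$F_n(x)=\begin{cases}\Phi_n(sx), & n\text{ odd},\\ (-1)^{\phi(n/2)}\,\Phi_{n/2}(-x^2), & n\text{ even}.\end{cases}$$ $C_n(x)$ and $D_n(x)$ are the monic polynomials with integer coefficients satisfying $F_n(x)=C_n(x)^2-n\,x\,D_n(x)^2$. $(a\,|\,b)$, for odd $b>0$, is the Jacobi symbol, with $(a\,|\,b)=0$ if $\gcd(a,b)>1$ and $(a\,|\,1)=1$. For $|y|<1$, $$g_n(y)=\sum_{j=0}^\infty (n\,|\,2j+1)\,\frac{y^{2j+1}}{2j+1}.$$ The derivative $g_n'$ is a rational function whose only poles are at zeros of $F_n(y^2)$, so $g_n$ continues analytically to $U$. Here $\sqrt n>0$. *)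

theory Defs
  imports
    "HOL-Complex_Analysis.Complex_Analysis"
    "HOL-Number_Theory.Number_Theory"
    "HOL-Computational_Algebra.Squarefree"
begin

definition cyclotomic :: "nat \<Rightarrow> complex poly" where
  "cyclotomic m = (\<Prod>k\<in>totatives m. [: - cis (2 * pi * real k / real m), 1 :])"

text \<open>The Jacobi symbol \<open>(a | b)\<close>, intended for odd \<open>b > 0\<close> only: the library's Legendre symbol
  is not the Kronecker symbol at the prime 2.\<close>

definition jacobi :: "int \<Rightarrow> nat \<Rightarrow> int" where
  "jacobi a b = (\<Prod>p\<in>#prime_factorization b. Legendre a (int p))"

definition aurif_F :: "nat \<Rightarrow> complex poly" where
  "aurif_F n =
     (if odd n then pcompose (cyclotomic n) [:0, if n mod 4 = 3 then -1 else 1:]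
      else (-1) ^ totient (n div 2) * pcompose (cyclotomic (n div 2)) [:0, 0, -1:])"

text \<open>Meaningful for \<open>norm y < 1\<close> only, where the series converges.\<close>

definition aurif_g :: "nat \<Rightarrow> complex \<Rightarrow> complex" where
  "aurif_g n y =
     (\<Sum>j. of_int (jacobi (int n) (2 * j + 1)) * (y ^ (2 * j + 1) / of_nat (2 * j + 1)))"

end

theory Submission
  imports Defs "Jordan_Normal_Form.Char_Poly"
begin

text \<open>
  Let \<open>A(y) = C(y\<^sup>2) + sqrt n y D(y\<^sup>2)\<close>, so that \<open>A(y) A(-y) = F\<^sub>n(y\<^sup>2)\<close>, and let \<open>S\<close> be the set of roots of
  \<open>A\<close>; they are \<open>4n\<close>-th roots of unity. Expanding logarithms, the formula
  \<open>A(y) / A(-y) = exp (2 sqrt n g\<^sub>n(y))\<close> on the unit disc amounts to the power sums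
  \<open>p\<^sub>m = \<Sum>z\<in>S. z ^ m\<close> being \<open>- (n | m) sqrt n\<close> for odd \<open>m\<close>, and it extends to \<open>U\<close> by the identity theorem.

  For odd \<open>m\<close>, \<open>p\<^sub>m = c\<^sub>m sqrt n\<close> with an integer \<open>c\<^sub>m\<close> by Newton's identities. For a prime \<open>p\<close> not
  dividing \<open>2n\<close>, reduction modulo \<open>p\<close> and Euler's criterion show that \<open>z \<mapsto> (n | p) z ^ p\<close> maps \<open>S\<close> to itself,
  whence \<open>c\<^sub>m = (n | m) c\<^sub>1\<close> for \<open>m\<close> coprime to \<open>2n\<close>. Reduction modulo the odd primes dividing \<open>n\<close> shows that
  \<open>gcd m n\<close> divides \<open>c\<^sub>m\<close>. Parseval's identity \<open>\<Sum> c\<^sub>m\<^sup>2 = \<phi>(4n)\<close>, over the odd \<open>m\<close> modulo \<open>4n\<close>, then leaves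
  no room for a nonzero \<open>c\<^sub>m\<close> with \<open>gcd m n > 1\<close> and forces \<open>c\<^sub>1 = \<plusminus>1\<close>; no Gauss sum or reciprocity law
  is needed. Finally \<open>c\<^sub>1 = - D(0) = - 1\<close> because \<open>D\<close> is monic and palindromic.
\<close>

section \<open>Congruences in the ring generated by a root of unity\<close>

definition int_adjoin :: "complex \<Rightarrow> complex set" where
  "int_adjoin w = range (\<lambda>h :: int poly. poly (map_poly of_int h) w)"

lemma of_int_in_int_adjoin [simp, intro]: "of_int k \<in> int_adjoin w"
  unfolding int_adjoin_def by (rule image_eqI[of _ _ "[:k:]"]) (simp_all add: of_int_hom.map_poly_pCons_hom)

lemma of_nat_in_int_adjoin [simp, intro]: "of_nat k \<in> int_adjoin w"
  using of_int_in_int_adjoin[of "int k" w] by simp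

lemma zero_in_int_adjoin [simp, intro]: "0 \<in> int_adjoin w"
  using of_int_in_int_adjoin[of 0 w] by simp

lemma one_in_int_adjoin [simp, intro]: "1 \<in> int_adjoin w"
  using of_int_in_int_adjoin[of 1 w] by simp

lemma generator_in_int_adjoin: "w \<in> int_adjoin w"
  unfolding int_adjoin_def by (rule image_eqI[of _ _ "[:0, 1:]"]) auto

lemma int_adjoin_add [intro]: "x \<in> int_adjoin w \<Longrightarrow> y \<in> int_adjoin w \<Longrightarrow> x + y \<in> int_adjoin w"
  unfolding int_adjoin_def by (auto simp: image_iff) (metis of_int_poly_hom.hom_add poly_add)

lemma int_adjoin_mult [intro]: "x \<in> int_adjoin w \<Longrightarrow> y \<in> int_adjoin w \<Longrightarrow> x * y \<in> int_adjoin w"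
  unfolding int_adjoin_def by (auto simp: image_iff) (metis of_int_poly_hom.hom_mult poly_mult)

lemma int_adjoin_minus [intro]: "x \<in> int_adjoin w \<Longrightarrow> - x \<in> int_adjoin w"
  using int_adjoin_mult[OF of_int_in_int_adjoin[of "- 1" w], of x] by simp

lemma int_adjoin_diff [intro]: "x \<in> int_adjoin w \<Longrightarrow> y \<in> int_adjoin w \<Longrightarrow> x - y \<in> int_adjoin w"
  using int_adjoin_add[of x w "- y"] by auto

lemma int_adjoin_power [intro]: "x \<in> int_adjoin w \<Longrightarrow> x ^ k \<in> int_adjoin w"
  by (induction k) auto

lemma int_adjoin_sum [intro]: "(\<And>i. i \<in> I \<Longrightarrow> f i \<in> int_adjoin w) \<Longrightarrow> sum f I \<in> int_adjoin w"
  by (induction I rule: infinite_finite_induct) auto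

lemma int_adjoin_prod [intro]: "(\<And>i. i \<in> I \<Longrightarrow> f i \<in> int_adjoin w) \<Longrightarrow> prod f I \<in> int_adjoin w"
  by (induction I rule: infinite_finite_induct) auto

lemma int_adjoin_poly:
  assumes "x \<in> int_adjoin w"
  shows "poly (map_poly of_int (h :: int poly)) x \<in> int_adjoin w"
  by (induction h) (use assms in \<open>auto simp: map_poly_pCons\<close>)

text \<open>Exponents of \<open>w\<close> count only modulo \<open>N\<close>, so \<open>Z[w]\<close>
  is a finitely generated abelian group; collecting the coefficients by residue class gives
  \<open>c\<close>.\<close>

lemma int_adjoin_unity_span:
  assumes w: "w ^ N = 1" and N: "N > 0" and x: "x \<in> int_adjoin w"
  obtains c :: "nat \<Rightarrow> int" where "x = (\<Sum>k<N. of_int (c k) * w ^ k)"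
proof -
  obtain h :: "int poly" where h: "x = poly (map_poly of_int h) w"
    using x by (auto simp: int_adjoin_def)
  define c where "c k = (\<Sum>i\<in>{i \<in> {..degree h}. i mod N = k}. poly.coeff h i)" for k
  have "x = (\<Sum>i\<le>degree h. of_int (poly.coeff h i) * w ^ i)"
    by (simp add: h poly_altdef)
  also have "\<dots> = (\<Sum>k<N. \<Sum>i\<in>{i \<in> {..degree h}. i mod N = k}. of_int (poly.coeff h i) * w ^ i)"
    using N by (intro sum.group [symmetric]) auto
  also have "\<dots> = (\<Sum>k<N. of_int (c k) * w ^ k)"
  proof (intro sum.cong refl)
    fix k
    have "w ^ i = w ^ (i mod N)" for i
    proof -
      have "w ^ i = w ^ (N * (i div N) + i mod N)" by simp
      also have "\<dots> = w ^ (i mod N)" by (simp only: power_add power_mult w) simp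
      finally show ?thesis .
    qed
    then show "(\<Sum>i\<in>{i \<in> {..degree h}. i mod N = k}. of_int (poly.coeff h i) * w ^ i)
        = of_int (c k) * w ^ k"
      unfolding c_def of_int_sum sum_distrib_right by (intro sum.cong refl) (metis (mono_tags, lifting) mem_Collect_eq)
  qed
  finally show thesis by (rule that)
qed

text \<open>Multiplication by \<open>x\<close> acts on the spanning vector of powers of \<open>w\<close> by an integer matrix,
  whose characteristic polynomial kills \<open>x\<close>.\<close>

lemma algebraic_int_int_adjoin:
  assumes w: "w ^ N = 1" and N: "N > 0" and x: "x \<in> int_adjoin w"
  shows "algebraic_int x"
proof -
  have "\<exists>c :: nat \<Rightarrow> int. x * w ^ j = (\<Sum>k<N. of_int (c k) * w ^ k)" for j
    using int_adjoin_unity_span[OF w N, of "x * w ^ j"] x generator_in_int_adjoin[of w]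
    by (meson int_adjoin_mult int_adjoin_power)
  then obtain M :: "nat \<Rightarrow> nat \<Rightarrow> int" where M: "\<And>j. x * w ^ j = (\<Sum>k<N. of_int (M j k) * w ^ k)"
    by metis
  define A :: "int mat" where "A = mat N N (\<lambda>(j, k). M j k)"
  define v where "v = vec N (\<lambda>k. w ^ k)"
  let ?A = "map_mat of_int A :: complex mat"
  have A: "A \<in> carrier_mat N N" "?A \<in> carrier_mat N N" by (auto simp: A_def)
  have "?A *\<^sub>v v = x \<cdot>\<^sub>v v"
    by (rule eq_vecI) (auto simp: A_def v_def scalar_prod_def M atLeast0LessThan)
  moreover have "v \<noteq> 0\<^sub>v N"
    using N by (auto simp: v_def vec_eq_iff)
  ultimately have "eigenvalue ?A x"
    using A by (auto simp: eigenvalue_def eigenvector_def v_def intro!: exI[of _ v])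
  then have "poly (char_poly ?A) x = 0"
    using eigenvalue_root_char_poly[OF A(2)] by simp
  then have "poly (map_poly of_int (char_poly A)) x = 0"
    by (simp add: of_int_hom.char_poly_hom[OF A(1)])
  then show ?thesis
    using degree_monic_char_poly[OF A(1)] by (auto simp: algebraic_int_altdef_ipoly)
qed

text \<open>The quotient \<open>a / b\<close> is rational and an algebraic integer, hence an
  integer. This carries divisibility in \<open>Z[w]\<close> back to the integers.\<close>

lemma dvd_of_int_adjoin:
  fixes a b :: int
  assumes w: "w ^ N = 1" and N: "N > 0" and x: "x \<in> int_adjoin w"
    and eq: "of_int a = of_int b * x" and b: "b \<noteq> 0"
  shows "b dvd a"
proof -
  have "x = of_int a / of_int b" using eq b by (simp add: field_simps)
  then have "x \<in> \<rat>" by simp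
  then have "x \<in> \<int>"
    using rational_algebraic_int_is_int algebraic_int_int_adjoin[OF w N x] by blast
  then obtain k where "x = of_int k" by (elim Ints_cases)
  then have "(of_int a :: complex) = of_int (b * k)" using eq by simp
  then show ?thesis unfolding of_int_eq_iff by simp
qed

section \<open>Congruences modulo a prime and the Frobenius map\<close>

text \<open>Congruence modulo the ideal \<open>p Z[w]\<close>; only the difference has to lie in the
  ring.\<close>

definition cong_adj :: "complex \<Rightarrow> nat \<Rightarrow> complex \<Rightarrow> complex \<Rightarrow> bool" where
  "cong_adj w p x y \<longleftrightarrow> (\<exists>t\<in>int_adjoin w. x - y = of_nat p * t)"

lemma cong_adj_refl [simp]: "cong_adj w p x x"
  by (auto simp: cong_adj_def intro: bexI[of _ 0])

lemma cong_adj_trans [trans]: "cong_adj w p x y \<Longrightarrow> cong_adj w p y z \<Longrightarrow> cong_adj w p x z"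
  unfolding cong_adj_def
proof (elim bexE)
  fix s t assume "s \<in> int_adjoin w" "t \<in> int_adjoin w" "x - y = of_nat p * s" "y - z = of_nat p * t"
  then show "\<exists>t\<in>int_adjoin w. x - z = of_nat p * t"
    by (intro bexI[of _ "s + t"]) (auto simp: algebra_simps)
qed

lemma cong_adj_add: "cong_adj w p x y \<Longrightarrow> cong_adj w p x' y' \<Longrightarrow> cong_adj w p (x + x') (y + y')"
  unfolding cong_adj_def
proof (elim bexE)
  fix s t assume "s \<in> int_adjoin w" "t \<in> int_adjoin w" "x - y = of_nat p * s" "x' - y' = of_nat p * t"
  then show "\<exists>t\<in>int_adjoin w. x + x' - (y + y') = of_nat p * t"
    by (intro bexI[of _ "s + t"]) (auto simp: algebra_simps)
qed

lemma cong_adj_mult_left: 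
  assumes "cong_adj w p x y" "z \<in> int_adjoin w" shows "cong_adj w p (z * x) (z * y)"
proof -
  from assms(1) obtain t where "t \<in> int_adjoin w" "x - y = of_nat p * t" by (auto simp: cong_adj_def)
  then show ?thesis
    unfolding cong_adj_def using assms(2)
    by (intro bexI[of _ "z * t"]) (auto simp: right_diff_distrib [symmetric])
qed

lemma cong_adj_of_int:
  assumes "[a = b] (mod int p)" shows "cong_adj w p (of_int a) (of_int b)"
proof -
  from assms obtain k where "a - b = int p * k" by (auto simp: cong_iff_dvd_diff)
  then have "of_int a - of_int b = (of_nat p * of_int k :: complex)" 
    by (metis of_int_diff of_int_mult of_int_of_nat_eq)
  then show ?thesis unfolding cong_adj_def by blast
qed

lemma cong_adj_frobenius_add:
  assumes p: "prime p" and x: "x \<in> int_adjoin w" and y: "y \<in> int_adjoin w"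
  shows "cong_adj w p ((x + y) ^ p) (x ^ p + y ^ p)"
proof -
  have p0: "p > 0" using p prime_gt_0_nat by blast
  \<comment> \<open>The inner terms of the binomial expansion, divided by \<open>p\<close>.\<close>
  define t where "t = (\<Sum>k\<in>{0<..<p}. of_nat ((p choose k) div p) * x ^ k * y ^ (p - k))"
  have "(x + y) ^ p = (\<Sum>k\<le>p. of_nat (p choose k) * x ^ k * y ^ (p - k))"
    by (rule binomial_ring)
  also have "{..p} = insert 0 (insert p {0<..<p})" using p0 by auto
  also have "(\<Sum>k\<in>\<dots>. of_nat (p choose k) * x ^ k * y ^ (p - k)) =
      y ^ p + (x ^ p + (\<Sum>k\<in>{0<..<p}. of_nat (p choose k) * x ^ k * y ^ (p - k)))"
    using p0 by simp
  also have "(\<Sum>k\<in>{0<..<p}. of_nat (p choose k) * x ^ k * y ^ (p - k)) = of_nat p * t"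
    unfolding t_def sum_distrib_left
  proof (intro sum.cong refl)
    fix k assume "k \<in> {0<..<p}"
    then have "p dvd (p choose k)"
      using p by (intro dvd_choose_prime) auto
    then have "of_nat (p choose k) = (of_nat p * of_nat ((p choose k) div p) :: complex)"
      by (metis dvd_mult_div_cancel of_nat_mult)
    then show "of_nat (p choose k) * x ^ k * y ^ (p - k)
       = of_nat p * (of_nat ((p choose k) div p) * x ^ k * y ^ (p - k))" by simp
  qed
  finally have "(x + y) ^ p - (x ^ p + y ^ p) = of_nat p * t" by simp
  moreover have "t \<in> int_adjoin w" unfolding t_def using x y by auto
  ultimately show ?thesis unfolding cong_adj_def by blast
qed

lemma cong_adj_frobenius_sum:
  assumes p: "prime p" and f: "\<And>i. i \<in> I \<Longrightarrow> f i \<in> int_adjoin w"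
  shows "cong_adj w p ((\<Sum>i\<in>I. f i) ^ p) (\<Sum>i\<in>I. f i ^ p)"
  using f
proof (induction I rule: infinite_finite_induct)
  case (insert a I)
  have "cong_adj w p ((f a + sum f I) ^ p) (f a ^ p + sum f I ^ p)"
    using insert.prems by (intro cong_adj_frobenius_add p) auto
  also have "cong_adj w p (f a ^ p + sum f I ^ p) (f a ^ p + (\<Sum>i\<in>I. f i ^ p))"
    using insert by (intro cong_adj_add) auto
  finally show ?case using insert.hyps by simp
qed (use p prime_gt_0_nat in \<open>auto simp: zero_power\<close>)

lemma fermat_little_int:
  assumes p: "prime p" shows "[a ^ p = a] (mod int p)"
proof -
  define b where "b = nat (a mod int p)"
  have p0: "p > 0" using p prime_gt_0_nat by blast
  then have ab: "[a = int b] (mod int p)"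
    by (simp add: b_def cong_def)
  have "[b ^ p = b] (mod p)"
  proof (cases "p dvd b")
    case True
    then show ?thesis
      using p0 by (meson cong_0_iff cong_sym cong_trans dvd_power dvd_trans)
  next
    case False
    have "b ^ p = b ^ (p - 1) * b" using p0 by (simp add: power_eq_if)
    then show ?thesis
      using cong_scalar_right[OF fermat_theorem[OF p False], of b] by simp
  qed
  then have "[int b ^ p = int b] (mod int p)"
    by (metis cong_int_iff of_nat_power)
  then show ?thesis
    using cong_pow[OF ab, of p] ab by (meson cong_sym cong_trans)
qed

text \<open>By Fermat's little theorem the integer coefficients are fixed modulo \<open>p\<close>,
  so the Frobenius map commutes with evaluating \<open>h\<close>.\<close>

lemma cong_adj_frobenius_poly:
  fixes h :: "int poly"
  assumes p: "prime p" and x: "x \<in> int_adjoin w"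
  shows "cong_adj w p (poly (map_poly of_int h) x ^ p) (poly (map_poly of_int h) (x ^ p))"
proof (induction h)
  case 0
  show ?case using p prime_gt_0_nat by (simp add: zero_power)
next
  case (pCons a h)
  let ?P = "\<lambda>h. poly (map_poly of_int h) :: complex \<Rightarrow> complex"
  have "cong_adj w p ((of_int a + x * ?P h x) ^ p) (of_int a ^ p + (x * ?P h x) ^ p)"
    using x int_adjoin_poly by (intro cong_adj_frobenius_add p) auto
  also have "cong_adj w p \<dots> (of_int a + x ^ p * ?P h (x ^ p))"
    unfolding power_mult_distrib of_int_power [symmetric]
    using x by (intro cong_adj_add cong_adj_mult_left pCons.IH cong_adj_of_int fermat_little_int p) auto
  finally show ?case by (simp add: of_int_hom.map_poly_pCons_hom)
qed

section \<open>Roots of unity, power sums and Jacobi symbols\<close>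

lemma norm_unity:
  fixes z :: complex
  assumes "z ^ N = 1" "N > 0"
  shows "norm z = 1"
proof -
  have "norm z ^ N = 1 ^ N" using assms(1) by (metis norm_one norm_power power_one)
  then show ?thesis using assms(2) power_eq_imp_eq_base[of "norm z" N 1] by simp
qed

lemma unity_in_int_adjoin:
  assumes "z ^ N = 1" "N > 0"
  shows "z \<in> int_adjoin (cis (2 * pi / real N))"
proof -
  obtain k where "z = cis (2 * pi * real k / real N)"
    using Complex.bij_betw_roots_unity[OF assms(2)] assms(1) unfolding bij_betw_def by blast
  then have "z = cis (2 * pi / real N) ^ k"
    by (subst Complex.DeMoivre) (simp add: field_simps)
  then show ?thesis
    by (simp add: int_adjoin_power generator_in_int_adjoin)
qed

lemma finite_unity: "N > 0 \<Longrightarrow> finite {z :: complex. z ^ N = 1}"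
  using Complex.bij_betw_roots_unity[of N] bij_betw_finite by blast

lemma unity_poly_eq_prod:
  assumes "N > 0"
  shows "(\<Prod>z\<in>{z :: complex. z ^ N = 1}. [:-z, 1:]) = Polynomial.monom 1 N - 1"
proof -
  let ?p = "Polynomial.monom 1 N - 1 :: complex poly"
  have deg: "degree ?p = N" "lead_coeff ?p = 1"
  proof -
    have "degree ?p = degree (Polynomial.monom 1 N :: complex poly)"
      unfolding diff_conv_add_uminus using assms
      by (intro degree_add_eq_left) (simp add: degree_monom_eq)
    then show "degree ?p = N" by (simp add: degree_monom_eq)
    then show "lead_coeff ?p = 1" using assms by simp
  qed
  \<comment> \<open>The derivative vanishes at most at 0, which is not a root.\<close>
  have "rsquarefree ?p"
    unfolding rsquarefree_roots using assms
    by (auto simp: poly_monom pderiv_diff pderiv_monom power_0_left)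
  from complex_poly_decompose_rsquarefree[OF this] show ?thesis
    using assms by (simp add: deg poly_monom)
qed

text \<open>The derivative of \<open>x^N - 1\<close> at \<open>\<xi>\<close> is
  \<open>N \<xi>^(N-1)\<close>, and it is also the product of \<open>\<xi> - z\<close> over all
  other roots \<open>z\<close>; the roots outside \<open>S\<close> go into the cofactor. So a prime
  dividing the product over \<open>S\<close> divides \<open>N\<close>: distinct roots of unity stay
  distinct modulo other primes.\<close>

lemma prod_diff_dvd_unity:
  assumes N: "N > 0" and S: "\<And>z. z \<in> S \<Longrightarrow> z ^ N = 1" and \<xi>: "\<xi> ^ N = 1" "\<xi> \<notin> S"
  obtains t where "t \<in> int_adjoin (cis (2 * pi / real N))" "of_nat N = (\<Prod>z\<in>S. \<xi> - z) * t"
proof -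
  let ?U = "{z :: complex. z ^ N = 1}"
  note adj = unity_in_int_adjoin[OF _ N]
  have fin: "finite ?U" using N by (rule finite_unity)
  define q where "q = (\<Prod>z\<in>?U - {\<xi>}. [:-z, 1:])"
  have "[:-\<xi>, 1:] * q = Polynomial.monom 1 N - 1"
    unfolding q_def unity_poly_eq_prod[OF N, symmetric]
    using prod.remove[OF fin, of \<xi> "\<lambda>z. [:-z, 1:]"] \<xi> by simp
  then have "poly (pderiv ([:-\<xi>, 1:] * q)) \<xi> = poly (pderiv (Polynomial.monom 1 N - 1)) \<xi>" by simp
  then have "poly q \<xi> = of_nat N * \<xi> ^ (N - 1)"
    unfolding pderiv_mult by (simp add: pderiv_diff pderiv_monom poly_monom pderiv_pCons)
  also have "poly q \<xi> = (\<Prod>z\<in>?U - {\<xi>}. \<xi> - z)"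
    by (simp add: q_def poly_prod)
  also have "\<dots> = (\<Prod>z\<in>?U - {\<xi>} - S. \<xi> - z) * (\<Prod>z\<in>S. \<xi> - z)"
    using fin S \<xi> by (intro prod.subset_diff) auto
  finally have "of_nat N * (\<xi> ^ (N - 1) * \<xi>) = (\<Prod>z\<in>S. \<xi> - z) * ((\<Prod>z\<in>?U - {\<xi>} - S. \<xi> - z) * \<xi>)"
    by (simp add: mult_ac)
  moreover have "\<xi> ^ (N - 1) * \<xi> = 1"
    using \<xi> N by (simp flip: power_Suc2)
  ultimately have "of_nat N = (\<Prod>z\<in>S. \<xi> - z) * ((\<Prod>z\<in>?U - {\<xi>} - S. \<xi> - z) * \<xi>)"
    by (simp only: mult_1_right)
  moreover have "(\<Prod>z\<in>?U - {\<xi>} - S. \<xi> - z) * \<xi> \<in> int_adjoin (cis (2 * pi / real N))"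
    using adj \<xi> by (intro int_adjoin_mult int_adjoin_prod int_adjoin_diff) auto
  ultimately show thesis by (rule that[rotated])
qed

lemma coeff_prod_linear_in_int_adjoin:
  assumes "\<And>z. z \<in> S \<Longrightarrow> z \<in> int_adjoin w"
  shows "poly.coeff (\<Prod>z\<in>S. [:-z, 1:]) k \<in> int_adjoin w"
  using assms
proof (induction S arbitrary: k rule: infinite_finite_induct)
  case (insert x S)
  then show ?case
    by (cases k) (auto simp: algebra_simps intro!: int_adjoin_minus)
qed (auto simp: coeff_1)

text \<open>An inverse \<open>u\<close> of \<open>a\<close> modulo \<open>N\<close>, from Bezout,
  undoes the power map; for \<open>a = 0\<close> coprimality forces \<open>N = 1\<close>.\<close>

lemma inj_on_power_unity:
  assumes "coprime a N"
  shows "inj_on (\<lambda>z :: complex. z ^ a) {z. z ^ N = 1}"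
proof (rule inj_onI)
  fix x y :: complex
  assume xy: "x \<in> {z. z ^ N = 1}" "y \<in> {z. z ^ N = 1}" "x ^ a = y ^ a"
  show "x = y"
  proof (cases "a = 0")
    case True
    then show ?thesis using assms xy by simp
  next
    case False
    obtain d u v where "d dvd a" "d dvd N" "a * u = N * v + d"
      using bezout_add_strong_nat[OF False, of N] by blast
    moreover from this have "d = 1"
      using assms coprime_common_divisor_nat by blast
    ultimately have uv: "a * u = N * v + 1" by simp
    have "z = (z ^ a) ^ u" if "z ^ N = 1" for z :: complex
      using that unfolding power_mult [symmetric] uv by (simp add: power_mult)
    from this[of x] this[of y] show ?thesis using xy by simp
  qed
qed

lemma coeff_pcompose_square:
  "poly.coeff (h \<circ>\<^sub>p [:0, 0, 1:]) k = (if even k then poly.coeff h (k div 2) else (0 :: 'a :: comm_ring_1))"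
proof (induction h arbitrary: k)
  case (pCons a h)
  show ?case
  proof (cases k)
    case (Suc k')
    then show ?thesis
      by (cases k') (auto simp: pcompose_pCons pCons.IH coeff_pCons split: nat.splits)
  qed (simp add: pcompose_pCons)
qed simp

text \<open>Logarithmic derivative: a factor \<open>1 - z X\<close> contributes
  \<open>-z / (1 - z X)\<close>, a geometric series. This is Newton's identities in
  generating-function form.\<close>

lemma fps_deriv_prod_linear:
  assumes "finite S"
  shows "fps_deriv (\<Prod>z\<in>S. 1 - fps_const z * fps_X) =
    - (\<Prod>z\<in>S. 1 - fps_const z * fps_X) * Abs_fps (\<lambda>k. \<Sum>z\<in>S. z ^ Suc k :: complex)"
  using assms
proof (induction S)
  case (insert x S)
  define P where "P = (\<Prod>z\<in>S. 1 - fps_const z * fps_X)"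
  define H where "H = Abs_fps (\<lambda>k. \<Sum>z\<in>S. z ^ Suc k)"
  \<comment> \<open>\<open>G\<close> is the expansion of \<open>x / (1 - x X)\<close>.\<close>
  define G where "G = Abs_fps (\<lambda>k. x ^ Suc k)"
  have IH: "fps_deriv P = - P * H" using insert.IH by (simp add: P_def H_def)
  have G: "(1 - fps_const x * fps_X) * G = fps_const x"
  proof (rule fps_ext)
    fix k show "fps_nth ((1 - fps_const x * fps_X) * G) k = fps_nth (fps_const x) k"
      by (cases k) (simp_all add: G_def left_diff_distrib mult.assoc)
  qed
  have "Abs_fps (\<lambda>k. \<Sum>z\<in>insert x S. z ^ Suc k) = G + H"
    using insert.hyps by (simp add: G_def H_def fps_eq_iff)
  moreover have "(\<Prod>z\<in>insert x S. 1 - fps_const z * fps_X) = (1 - fps_const x * fps_X) * P"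
    using insert.hyps by (simp add: P_def)
  moreover have "fps_deriv ((1 - fps_const x * fps_X) * P) =
     - ((1 - fps_const x * fps_X) * P) * (G + H)"
  proof -
    have "fps_deriv ((1 - fps_const x * fps_X) * P) =
       - fps_const x * P + (1 - fps_const x * fps_X) * (- P * H)"
      using IH by (simp add: fps_deriv_mult)
    also have "\<dots> = - ((1 - fps_const x * fps_X) * G) * P + (1 - fps_const x * fps_X) * (- P * H)"
      by (simp only: G)
    also have "\<dots> = - ((1 - fps_const x * fps_X) * P) * (G + H)"
      by (simp add: algebra_simps)
    finally show ?thesis .
  qed
  ultimately show ?case by (simp only:)
qed (simp add: fps_eq_iff)

section \<open>The Jacobi symbol and induction over prime factors\<close>

lemma jacobi_mult:
  "b > 0 \<Longrightarrow> c > 0 \<Longrightarrow> jacobi a (b * c) = jacobi a b * jacobi a c"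
  by (simp add: jacobi_def prime_factorization_mult)

lemma jacobi_1 [simp]: "jacobi a 1 = 1" "jacobi a (Suc 0) = 1"
  by (simp_all add: jacobi_def)

lemma jacobi_prime: "prime p \<Longrightarrow> jacobi a p = Legendre a (int p)"
  by (simp add: jacobi_def prime_factorization_prime)

lemma jacobi_eq_0:
  assumes "\<not> coprime n m" "m > 0"
  shows "jacobi (int n) m = 0"
proof -
  obtain p where p: "prime p" "p dvd n" "p dvd m"
    using assms(1) by (metis coprime_iff_gcd_eq_1 gcd_nat.bounded_iff prime_factor_nat)
  have "Legendre (int n) (int p) = 0"
    using p by (simp add: Legendre_def cong_0_iff)
  moreover have "p \<in># prime_factorization m"
    using p assms(2) by (simp add: prime_factors_dvd)
  ultimately show ?thesis by (auto simp: jacobi_def)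
qed

lemma Legendre_cases: "\<not> p dvd n \<Longrightarrow> Legendre (int n) (int p) = 1 \<or> Legendre (int n) (int p) = - 1"
  by (auto simp: Legendre_def cong_0_iff)

text \<open>Prime factors are split off one at a time; the premise \<open>p * k dvd m\<close> lets
  oddness and coprimality pass from \<open>m\<close> to \<open>p\<close> and
  \<open>k\<close>.\<close>

lemma prime_induct_nat [consumes 1, case_names one mult]:
  fixes m :: nat
  assumes "m > 0" "P 1" "\<And>p k. prime p \<Longrightarrow> k > 0 \<Longrightarrow> p * k dvd m \<Longrightarrow> P k \<Longrightarrow> P (p * k)"
  shows "P m"
proof -
  have "k dvd m \<longrightarrow> P k" for k
  proof (induction k rule: less_induct)
    case (less k)
    show ?case
    proof
      assume k: "k dvd m"
      then have k0: "k > 0" using assms(1) by (auto intro: Nat.gr0I)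
      show "P k"
      proof (cases "k = 1")
        case False
        then obtain p where p: "prime p" "p dvd k" using prime_factor_nat by blast
        then obtain j where j: "k = p * j" by auto
        then have "j < k" "j > 0" "j dvd m"
          using k0 k prime_gt_1_nat[OF p(1)] by (auto intro: dvd_mult_right Nat.gr0I)
        then show ?thesis using less.IH[of j] assms(3)[OF p(1)] j k by blast
      qed (use assms in simp)
    qed
  qed
  then show ?thesis by simp
qed

lemma jacobi_cases:
  assumes "coprime m n" "m > 0"
  shows "jacobi (int n) m = 1 \<or> jacobi (int n) m = - 1"
  using assms(2)
proof (induction m rule: prime_induct_nat)
  case (mult p k)
  then have "\<not> p dvd n"
    using assms(1) by (metis coprime_common_divisor dvd_mult_left not_prime_unit)
  then show ?case
    using mult Legendre_cases[of p n] by (auto simp: jacobi_mult jacobi_prime prime_gt_0_nat)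
qed simp

section \<open>Power sums of the roots of an Aurifeuillian factor\<close>

text \<open>Each prime has multiplicity at most 1 in \<open>d\<close>, so divisibility can be tested
  prime by prime.\<close>

lemma squarefree_dvdI:
  fixes d x :: nat
  assumes "squarefree d" "\<And>p. prime p \<Longrightarrow> p dvd d \<Longrightarrow> p dvd x"
  shows "d dvd x"
proof (cases "x = 0")
  case False
  have d: "d \<noteq> 0" by (metis assms(1) not_squarefree_0)
  show ?thesis
  proof (rule multiplicity_le_imp_dvd[OF d])
    fix p :: nat assume p: "prime p"
    have "multiplicity p d \<le> 1" using assms(1) d p by (simp add: squarefree_factorial_semiring'')
    moreover have "multiplicity p x \<ge> 1" if "p dvd d"
      using assms(2)[OF p that] False p by (metis One_nat_def multiplicity_gt_zero_iff not_prime_unit Suc_leI)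
    moreover have "multiplicity p d = 0" if "\<not> p dvd d"
      using that by (rule not_dvd_imp_multiplicity_0)
    ultimately show "multiplicity p d \<le> multiplicity p x" by fastforce
  qed
qed simp

section \<open>An Aurifeuillian factor as a polynomial in \<open>y\<close>, and its roots\<close>

text \<open>This is \<open>F_n^+(x)\<close> with \<open>x = y^2\<close> and \<open>y\<close> as the
  chosen root of \<open>x\<close>; replacing \<open>y\<close> by \<open>-y\<close> gives
  \<open>F_n^-(x)\<close>.\<close>

definition aurif_poly :: "nat \<Rightarrow> int poly \<Rightarrow> int poly \<Rightarrow> complex poly" where
  "aurif_poly n C D = (map_poly of_int C \<circ>\<^sub>p [:0, 0, 1:]) +
     [:0, of_real (sqrt n):] * (map_poly of_int D \<circ>\<^sub>p [:0, 0, 1:])"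

lemma poly_aurif_poly: "poly (aurif_poly n C D) y =
    poly (map_poly of_int C) (y\<^sup>2) + of_real (sqrt n) * y * poly (map_poly of_int D) (y\<^sup>2)"
  by (simp add: aurif_poly_def poly_pcompose power2_eq_square algebra_simps)

lemma coeff_aurif_poly:
  "poly.coeff (aurif_poly n C D) k =
    (if even k then of_int (poly.coeff C (k div 2)) else of_real (sqrt n) * of_int (poly.coeff D (k div 2)))"
proof (cases k)
  case 0
  then show ?thesis by (simp add: aurif_poly_def coeff_pcompose_square poly_0_coeff_0)
next
  case (Suc j)
  have "poly.coeff ([:0, of_real (sqrt n) :: complex:] * q) (Suc j) =
      of_real (sqrt n) * poly.coeff q j" for q by simp
  then show ?thesis
    unfolding aurif_poly_def Polynomial.coeff_add coeff_pcompose_square Suc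
    by (simp add: coeff_pcompose_square)
qed

text \<open>Collects the facts on \<open>A\<close> and its roots from which the power sums are
  computed, free of cyclotomic polynomials. They are established in
  \<open>aurif_roots_aurif_poly\<close>, where \<open>neg_notin\<close> comes from
  \<open>A(y) A(-y)\<close> being squarefree.\<close>

locale aurif_roots =
  fixes n :: nat and C D :: "int poly" and A :: "complex poly" and S :: "complex set"
  assumes n: "n > 1" "squarefree n"
    and lead_D: "lead_coeff D = 1"
    and A_def: "A = aurif_poly n C D"
    and A_prod: "A = (\<Prod>z\<in>S. [:-z, 1:])"
    and A_0: "poly A 0 = 1"
    and finite_S: "finite S"
    and unity: "z \<in> S \<Longrightarrow> z ^ (4 * n) = 1"
    and neg_notin: "z \<in> S \<Longrightarrow> - z \<notin> S"
    and cnj_in: "z \<in> S \<Longrightarrow> cnj z \<in> S"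
    and card_S: "2 * card S = totient (4 * n)" "even (card S)"
begin

abbreviation s :: complex where "s \<equiv> of_real (sqrt n)"
definition w :: complex where "w = cis (2 * pi / real (4 * n))"

lemma s_power2: "s\<^sup>2 = of_nat n"
  by (simp flip: of_real_power)

lemma s_nonzero: "s \<noteq> 0"
  using n by simp

lemmas poly_A = poly_aurif_poly[of n C D, folded A_def]

lemma poly_A_prod: "poly A y = (\<Prod>z\<in>S. y - z)"
  by (simp add: A_prod poly_prod)

lemma poly_A_eq_0_iff: "poly A z = 0 \<longleftrightarrow> z \<in> S"
  using finite_S by (auto simp: poly_A_prod)

lemmas coeff_A = coeff_aurif_poly[of n C D, folded A_def]

lemma S_in_adjoin: "z \<in> S \<Longrightarrow> z \<in> int_adjoin w"
  using unity_in_int_adjoin[OF unity] n by (simp add: w_def)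

text \<open>As \<open>D\<close> is monic, \<open>sqrt n\<close> is itself a coefficient of
  \<open>A\<close>, hence an integer polynomial in the roots of \<open>A\<close>.\<close>

lemma s_in_adjoin: "s \<in> int_adjoin w"
proof -
  have "s = poly.coeff A (2 * degree D + 1)"
    using lead_D by (simp add: coeff_A)
  also have "\<dots> \<in> int_adjoin w"
    unfolding A_prod by (intro coeff_prod_linear_in_int_adjoin S_in_adjoin)
  finally show ?thesis .
qed

lemma adjoin_dvd:
  assumes "x \<in> int_adjoin w" "of_int a = of_int b * x" "b \<noteq> 0" shows "b dvd a"
proof (rule dvd_of_int_adjoin[OF _ _ assms])
  show "w ^ (4 * n) = 1" unfolding w_def by (subst Complex.DeMoivre) (use n in simp)
  show "4 * n > 0" using n by simp
qed

lemma S_nonzero: "z \<in> S \<Longrightarrow> z \<noteq> 0"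
  using unity[of 0] n by (auto simp: power_0_left)

lemma cnj_S_eq_inverse: "z \<in> S \<Longrightarrow> cnj z = inverse z"
proof -
  assume z: "z \<in> S"
  then have "norm z = 1" using norm_unity[OF unity] n by simp
  then show ?thesis by (simp add: inverse_eq_divide complex_div_cnj[of 1])
qed

lemma inverse_in: "z \<in> S \<Longrightarrow> inverse z \<in> S"
  using cnj_in[of z] cnj_S_eq_inverse by simp

lemma image_inverse_S: "inverse ` S = S"
  using inverse_in by (auto simp: image_iff) (metis inverse_inverse_eq)

text \<open>Frobenius at \<open>p\<close>: modulo \<open>p\<close> it sends \<open>sqrt n\<close> to \<open>(n | p) sqrt n\<close>, hence a root \<open>z\<close> of
  \<open>A\<close> to a root of \<open>A\<close> or of \<open>A(-y)\<close>; this lifts to characteristic 0 because the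
  \<open>4 n\<close>-th roots of unity stay distinct modulo \<open>p\<close>.\<close>

lemma frobenius_S:
  assumes z: "z \<in> S" and p: "prime p" "odd p" "\<not> p dvd n"
  shows "of_int (Legendre (int n) (int p)) * z ^ p \<in> S"
proof (rule ccontr)
  define e where "e = Legendre (int n) (int p)"
  define \<xi> where "\<xi> = of_int e * z ^ p"
  assume "\<not> ?thesis"
  then have \<xi>: "\<xi> \<notin> S" by (simp add: \<xi>_def e_def)
  let ?P = "\<lambda>h. poly (map_poly of_int h) :: complex \<Rightarrow> complex"
  have e: "e = 1 \<or> e = - 1" using Legendre_cases p by (simp add: e_def)
  \<comment> \<open>Being a sign, \<open>e\<close> drops out of \<open>\<xi>\<^sup>2\<close>; it
    survives only in \<open>s * \<xi>\<close>, where it matches the factor that Euler's criterion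
    extracts from \<open>s ^ p\<close>.\<close>
  then have \<xi>2: "\<xi>\<^sup>2 = (z\<^sup>2) ^ p" 
    by (auto simp: \<xi>_def power_mult_distrib power_mult [symmetric] mult.commute[of p 2])
  have p2: "p > 2" using p by (metis dvd_refl le_neq_implies_less prime_ge_2_nat)
  have s_pow: "s ^ p = of_int (int n ^ ((p - 1) div 2)) * s"
  proof -
    have "p = 2 * ((p - 1) div 2) + 1" using p(2) by auto
    then have "s ^ p = (s\<^sup>2) ^ ((p - 1) div 2) * s" by (metis power_mult power_add power_one_right)
    then show ?thesis by (simp add: s_power2)
  qed
  have zadj: "z \<in> int_adjoin w" using z by (rule S_in_adjoin)
  have "cong_adj w p 0 (poly A z ^ p)"
    using z poly_A_eq_0_iff[of z] prime_gt_0_nat[OF p(1)] by (simp add: zero_power)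
  also have "cong_adj w p (poly A z ^ p) (?P C (z\<^sup>2) ^ p + (s * z * ?P D (z\<^sup>2)) ^ p)"
    unfolding poly_A using zadj s_in_adjoin
    by (intro cong_adj_frobenius_add p int_adjoin_mult int_adjoin_poly int_adjoin_power)
  also have "cong_adj w p \<dots> (?P C ((z\<^sup>2) ^ p) + s * z ^ p * of_int e * ?P D ((z\<^sup>2) ^ p))"
  proof (intro cong_adj_add)
    have "cong_adj w p ((s * z * ?P D (z\<^sup>2)) ^ p) (s ^ p * z ^ p * ?P D ((z\<^sup>2) ^ p))"
      unfolding power_mult_distrib using zadj s_in_adjoin
      by (intro cong_adj_mult_left cong_adj_frobenius_poly p int_adjoin_mult int_adjoin_power)
    also have "s ^ p * z ^ p * ?P D ((z\<^sup>2) ^ p) =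
        s * z ^ p * ?P D ((z\<^sup>2) ^ p) * of_int (int n ^ ((p - 1) div 2))"
      by (simp add: s_pow)
    also have "cong_adj w p \<dots> (s * z ^ p * ?P D ((z\<^sup>2) ^ p) * of_int e)"
      using zadj s_in_adjoin p2 p(1) unfolding e_def
      by (intro cong_adj_mult_left cong_adj_of_int cong_sym[OF euler_criterion] 
            int_adjoin_mult int_adjoin_poly int_adjoin_power)
    finally show "cong_adj w p ((s * z * ?P D (z\<^sup>2)) ^ p) (s * z ^ p * of_int e * ?P D ((z\<^sup>2) ^ p))"
      by (simp add: mult_ac)
  qed (intro cong_adj_frobenius_poly p int_adjoin_power zadj)
  also have "?P C ((z\<^sup>2) ^ p) + s * z ^ p * of_int e * ?P D ((z\<^sup>2) ^ p) = poly A \<xi>"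
    unfolding poly_A \<xi>2 by (simp add: \<xi>_def mult_ac)
  finally obtain u where u: "u \<in> int_adjoin w" "poly A \<xi> = of_nat p * u"
    by (auto simp: cong_adj_def) (metis int_adjoin_minus minus_equation_iff mult_minus_right)
  have "z ^ (p * (4 * n)) = 1"
    using unity[OF z] by (metis mult.commute power_mult power_one)
  then have "\<xi> ^ (4 * n) = 1"
    using e by (auto simp: \<xi>_def power_mult_distrib simp flip: power_mult)
  \<comment> \<open>\<open>poly A \<xi>\<close> is divisible by \<open>p\<close> and, since
    \<open>\<xi>\<close> is a \<open>4n\<close>-th root of unity outside \<open>S\<close>, divides
    \<open>4n\<close>. So \<open>p\<close> would divide \<open>4n\<close>.\<close>
  then obtain t where t: "t \<in> int_adjoin w" "of_nat (4 * n) = (\<Prod>z\<in>S. \<xi> - z) * t"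
    using prod_diff_dvd_unity[of "4 * n" S \<xi>] unity \<xi> n unfolding w_def by auto
  have "of_int (int (4 * n)) = of_int (int p) * (u * t)"
    using t(2) u(2) unfolding poly_A_prod by simp
  then have "int p dvd int (4 * n)"
    using p2 by (intro adjoin_dvd[OF int_adjoin_mult[OF u(1) t(1)]]) auto
  then have "p dvd 4 * n" by presburger
  then have "p dvd 4"
    using p prime_dvd_mult_nat by blast
  moreover have "(4::nat) = 2 ^ 2" by simp
  ultimately have "p dvd 2"
    using p(1) prime_dvd_power_nat by metis
  then show False using p2 by (auto dest: dvd_imp_le)
qed

text \<open>Iterates \<open>frobenius_S\<close> over the prime factors of \<open>m\<close>; the sign
  collected so far is raised to an odd power and thus kept.\<close>

lemma jacobi_S:
  assumes "m > 0" "odd m" "coprime m n" "z \<in> S"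
  shows "of_int (jacobi (int n) m) * z ^ m \<in> S"
  using assms(1)
proof (induction m rule: prime_induct_nat)
  case (mult p k)
  define e where "e = jacobi (int n) k"
  define f where "f = Legendre (int n) (int p)"
  have p: "odd p" "\<not> p dvd n"
    using mult assms by (meson dvd_trans dvd_mult_left, metis coprime_common_divisor dvd_mult_left not_prime_unit)
  then have e: "f * (e * e ^ (p - 1)) = f * e"
  proof -
    have "coprime k n" using mult assms(3) by (meson coprime_divisors dvd_mult_right dvd_refl)
    then have "e = 1 \<or> e = - 1" using jacobi_cases mult by (simp add: e_def)
    moreover have "even (p - 1)" using p by simp
    ultimately show ?thesis by auto
  qed
  have "of_int f * (of_int e * z ^ k) ^ p \<in> S"
    using frobenius_S[OF mult.IH mult.hyps(1) p] by (simp add: e_def f_def)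
  also have "of_int f * (of_int e * z ^ k) ^ p = of_int (f * e ^ p) * z ^ (p * k)"
    by (simp add: power_mult_distrib mult.commute flip: power_mult)
  also have "e ^ p = e * e ^ (p - 1)" using p(1) by (cases p) auto
  also have "f * (e * e ^ (p - 1)) = jacobi (int n) (p * k)"
    using mult prime_gt_0_nat unfolding e by (simp add: e_def f_def jacobi_mult jacobi_prime)
  finally show ?case .
qed (use assms in simp)

definition psum :: "nat \<Rightarrow> complex" where "psum m = (\<Sum>z\<in>S. z ^ m)"

text \<open>The map \<open>?f\<close> is an injection of the finite set \<open>S\<close> into
  itself, hence a permutation. Reindexing the power sum by it brings out the sign, since
  \<open>m\<close> is odd.\<close>

lemma psum_mult:
  assumes a: "a > 0" "odd a" "coprime a n" and m: "odd m"
  shows "psum (a * m) = of_int (jacobi (int n) a) * psum m"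
proof -
  define e where "e = jacobi (int n) a"
  have e: "e = 1 \<or> e = - 1" using jacobi_cases a by (simp add: e_def)
  let ?f = "\<lambda>z. of_int e * z ^ a :: complex"
  have maps: "?f ` S \<subseteq> S" using jacobi_S[OF a] by (auto simp: e_def)
  have "coprime a (4 * n)"
  proof -
    have "coprime a (2 * 2)" using a(2) unfolding coprime_mult_right_iff by simp
    then show ?thesis using a(3) by simp
  qed
  then have "inj_on (\<lambda>z :: complex. z ^ a) S"
    by (rule inj_on_subset[OF inj_on_power_unity]) (use unity in auto)
  then have inj: "inj_on ?f S"
    using e by (auto simp: inj_on_def)
  have "psum m = (\<Sum>z\<in>?f ` S. z ^ m)"
    using endo_inj_surj[OF finite_S maps inj] by (simp add: psum_def)
  also have "\<dots> = (\<Sum>z\<in>S. of_int (e ^ m) * z ^ (a * m))"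
    by (simp add: sum.reindex[OF inj] power_mult_distrib power_mult)
  also have "\<dots> = of_int e * psum (a * m)"
    using e m by (auto simp: psum_def sum_negf)
  finally show ?thesis using e by (auto simp: e_def)
qed

section \<open>Newton's identities and integrality of the power sums\<close>

text \<open>Inversion permutes \<open>S\<close>, and the product of all \<open>-z\<close> is
  \<open>A(0) = 1\<close>.\<close>

lemma A_prod': "A = (\<Prod>z\<in>S. [:1, -z:])"
proof -
  have "A = (\<Prod>z\<in>S. Polynomial.smult (-z) [:1, - inverse z:])"
    unfolding A_prod by (intro prod.cong refl) (use S_nonzero in auto)
  also have "\<dots> = Polynomial.smult (\<Prod>z\<in>S. -z) (\<Prod>z\<in>S. [:1, - inverse z:])"
    by (rule prod_smult)
  also have "(\<Prod>z\<in>S. -z) = 1"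
    using A_0 by (simp add: poly_A_prod)
  also have "(\<Prod>z\<in>S. [:1, - inverse z:]) = (\<Prod>z\<in>inverse ` S. [:1, - z:])"
    by (subst prod.reindex) (auto simp: inj_on_def)
  finally show ?thesis by (simp add: image_inverse_S)
qed

lemma newton:
  "of_nat (Suc k) * poly.coeff A (Suc k) = - (\<Sum>i\<le>k. poly.coeff A i * psum (Suc (k - i)))"
proof -
  have "fps_of_poly A = (\<Prod>z\<in>S. 1 - fps_const z * fps_X)"
    unfolding A_prod' fps_of_poly_prod
    by (intro prod.cong refl) (simp add: fps_of_poly_pCons fps_const_neg [symmetric] mult.commute del: fps_const_neg)
  then have "fps_deriv (fps_of_poly A) = - fps_of_poly A * Abs_fps (\<lambda>k. psum (Suc k))"
    using fps_deriv_prod_linear[OF finite_S] by (simp add: psum_def)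
  then have "fps_nth (fps_deriv (fps_of_poly A)) k = fps_nth (- fps_of_poly A * Abs_fps (\<lambda>k. psum (Suc k))) k"
    by simp
  then show ?thesis
    by (simp add: fps_mult_nth atLeast0AtMost sum_negf)
qed

lemma psum_1: "psum 1 = - s * of_int (poly.coeff D 0)"
  using newton[of 0] A_0 by (simp add: poly_0_coeff_0 coeff_A minus_equation_iff)

text \<open>Swapping the sign of \<open>s\<close> swaps the sign of \<open>y\<close> in \<open>A\<close>; so the coefficients of \<open>A\<close> and the
  power sums of odd weight are integral multiples of \<open>s\<close>, those of even weight are integers.\<close>

definition graded :: "nat \<Rightarrow> complex \<Rightarrow> bool" where
  "graded k x \<longleftrightarrow> (\<exists>c :: int. x = (if even k then 1 else s) * of_int c)"

lemma graded_add: "graded k x \<Longrightarrow> graded k y \<Longrightarrow> graded k (x + y)"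
  unfolding graded_def by (metis distrib_left of_int_add)

lemma graded_uminus: "graded k x \<Longrightarrow> graded k (- x)"
  unfolding graded_def by (metis mult_minus_right of_int_minus)

lemma graded_mult: "graded j x \<Longrightarrow> graded k y \<Longrightarrow> graded (j + k) (x * y)"
  unfolding graded_def
proof (elim exE)
  fix c d :: int
  assume xy: "x = (if even j then 1 else s) * of_int c" "y = (if even k then 1 else s) * of_int d"
  have "s * s = of_int (int n)" using s_power2 by (simp add: power2_eq_square)
  \<comment> \<open>Two factors of odd weight contribute \<open>s * s = n\<close>.\<close>
  then show "\<exists>c :: int. x * y = (if even (j + k) then 1 else s) * of_int c"
    using xy by (intro exI[of _ "(if odd j \<and> odd k then int n else 1) * c * d"]) (auto simp: mult_ac)
qed

lemma graded_sum: "(\<And>i. i \<in> I \<Longrightarrow> graded k (f i)) \<Longrightarrow> graded k (sum f I)"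
proof (induction I rule: infinite_finite_induct)
  case (insert x F)
  then show ?case by (simp add: graded_add)
qed (auto simp: graded_def intro: exI[of _ 0])

lemma graded_coeff_A: "graded k (poly.coeff A k)"
  by (auto simp: graded_def coeff_A)

text \<open>Newton's identities are solved for the newest power sum, whose coefficient is
  \<open>A(0) = 1\<close>; so no division occurs.\<close>

lemma graded_psum: "graded (Suc k) (psum (Suc k))"
proof (induction k rule: less_induct)
  case (less k)
  have "(\<Sum>i\<le>k. poly.coeff A i * psum (Suc (k - i))) =
      psum (Suc k) + (\<Sum>i\<in>{1..k}. poly.coeff A i * psum (Suc (k - i)))"
  proof -
    have "{..k} = insert 0 {1..k}" by auto
    then show ?thesis using A_0 by (simp add: poly_0_coeff_0)
  qed
  then have eq: "psum (Suc k) = - (of_nat (Suc k) * poly.coeff A (Suc k) +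
      (\<Sum>i\<in>{1..k}. poly.coeff A i * psum (Suc (k - i))))"
    using newton[of k] by simp
  have "graded (Suc k) (poly.coeff A i * psum (Suc (k - i)))" if "i \<in> {1..k}" for i
    using graded_mult[OF graded_coeff_A[of i] less.IH[of "k - i"]] that by auto
  moreover have "graded (Suc k) (of_nat (Suc k) * poly.coeff A (Suc k))"
    using graded_mult[of 0 "of_nat (Suc k)" "Suc k"] graded_coeff_A
    by (metis add_0 even_zero graded_def mult_1 of_int_of_nat_eq)
  ultimately show ?case
    unfolding eq by (intro graded_uminus graded_add graded_sum) auto
qed

text \<open>The integer \<open>c_m\<close> with \<open>p_m = c_m sqrt n\<close>; it is meaningful
  for odd \<open>m\<close>.\<close>

definition cpsum :: "nat \<Rightarrow> int" where "cpsum m = (SOME c. psum m = s * of_int c)"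

lemma psum_odd: "odd m \<Longrightarrow> psum m = s * of_int (cpsum m)"
  unfolding cpsum_def by (rule someI_ex, cases m) (use graded_psum[of "m - 1"] in \<open>auto simp: graded_def\<close>)

lemma cpsum_eqI: "odd m \<Longrightarrow> psum m = s * of_int c \<Longrightarrow> cpsum m = c"
  using psum_odd[of m] s_nonzero by simp

lemma cpsum_mult:
  "a > 0 \<Longrightarrow> odd a \<Longrightarrow> coprime a n \<Longrightarrow> odd m \<Longrightarrow> cpsum (a * m) = jacobi (int n) a * cpsum m"
  by (rule cpsum_eqI) (simp_all add: psum_mult psum_odd[of m])

lemma cpsum_mod: "odd m \<Longrightarrow> cpsum (m mod (4 * n)) = cpsum m"
proof (rule cpsum_eqI)
  assume m: "odd m"
  show "odd (m mod (4 * n))" using m by (simp add: dvd_mod_iff)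
  have "z ^ (m mod (4 * n)) = z ^ m" if "z \<in> S" for z
  proof -
    have "z ^ m = z ^ (4 * n * (m div (4 * n)) + m mod (4 * n))" by simp
    also have "\<dots> = z ^ (m mod (4 * n))" by (simp only: power_add power_mult [of z "4 * n"] unity[OF that]) simp
    finally show ?thesis by simp
  qed
  then show "psum (m mod (4 * n)) = s * of_int (cpsum m)"
    using psum_odd[OF m] by (simp add: psum_def)
qed

section \<open>Divisibility of \<open>c_m\<close> by \<open>gcd m n\<close>\<close>

text \<open>By Frobenius, \<open>p_m^q\<close> and \<open>p_(qm)\<close> agree modulo
  \<open>q\<close>, and the former is divisible by \<open>q\<close> because \<open>s^q\<close>
  contains \<open>s^2 = n\<close>. Squaring \<open>s * c_(qm)\<close> shows that \<open>q^2\<close>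
  divides \<open>n * c_(qm)^2\<close>, where \<open>n\<close> accounts for a single factor
  \<open>q\<close>.\<close>

lemma prime_dvd_cpsum:
  assumes q: "prime q" "odd q" "q dvd n" and m: "odd m"
  shows "int q dvd cpsum (q * m)"
proof -
  have q2: "q > 2" using q by (metis dvd_refl le_neq_implies_less prime_ge_2_nat)
  have "cong_adj w q (psum m ^ q) (psum (q * m))"
    unfolding psum_def mult.commute[of q] power_mult
    using S_in_adjoin by (intro cong_adj_frobenius_sum q) auto
  then obtain t where t: "t \<in> int_adjoin w" "psum m ^ q - psum (q * m) = of_nat q * t"
    by (auto simp: cong_adj_def)
  obtain r where r: "n = q * r" using q by auto
  define u where "u = s ^ (q - 2) * of_nat r * of_int (cpsum m) ^ q - t"
  have u: "u \<in> int_adjoin w"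
    unfolding u_def using s_in_adjoin t by (intro int_adjoin_diff int_adjoin_mult int_adjoin_power) auto
  have "psum m ^ q = s ^ q * of_int (cpsum m) ^ q"
    using m by (simp add: psum_odd power_mult_distrib)
  also have "s ^ q = s ^ (q - 2) * s\<^sup>2"
    using q2 by (metis le_add_diff_inverse2 less_imp_le power_add)
  also have "\<dots> = of_nat q * (s ^ (q - 2) * of_nat r)"
    unfolding s_power2 by (simp add: r)
  finally have "s * of_int (cpsum (q * m)) = of_nat q * u"
    using t(2) q m psum_odd[of "q * m"] by (simp add: u_def algebra_simps)
  then have "(s * of_int (cpsum (q * m)))\<^sup>2 = (of_nat q * u)\<^sup>2" by simp
  then have "of_int (int n * cpsum (q * m) ^ 2) = of_int (int q ^ 2) * u\<^sup>2"
    by (simp add: power_mult_distrib s_power2)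
  then have "int q ^ 2 dvd int n * cpsum (q * m) ^ 2"
    using q2 by (intro adjoin_dvd[OF int_adjoin_power[OF u, of 2]]) auto
  then have "int q dvd int r * cpsum (q * m) ^ 2"
    using q2 by (simp add: r power2_eq_square mult.assoc)
  moreover have "\<not> q dvd r"
  proof
    assume "q dvd r"
    then have "q\<^sup>2 dvd n" by (auto simp: r power2_eq_square)
    then show False using n(2) q2 by (auto simp: squarefree_def)
  qed
  ultimately show ?thesis
    using q(1) by (metis int_dvd_int_iff prime_dvd_mult_iff prime_dvd_power prime_nat_int_transfer)
qed

text \<open>The gcd is squarefree and odd, so it suffices to treat its primes one by one.\<close>

lemma gcd_dvd_cpsum:
  assumes m: "odd m"
  shows "int (gcd m n) dvd cpsum m"
proof -
  have "gcd m n dvd nat \<bar>cpsum m\<bar>"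
  proof (rule squarefree_dvdI)
    show "squarefree (gcd m n)" using n(2) squarefree_mono by blast
    fix q assume "prime q" "q dvd gcd m n"
    then have q: "prime q" "q dvd n" "q dvd m" by auto
    then obtain j where j: "m = q * j" by auto
    then have "odd q" "odd j" using m by auto
    then have "int q dvd cpsum m"
      using prime_dvd_cpsum[OF q(1) _ q(2)] j by simp
    then show "q dvd nat \<bar>cpsum m\<bar>" by (simp only: dvd_nat_abs_iff)
  qed
  then show ?thesis by (simp only: dvd_nat_abs_iff)
qed

end

section \<open>The logarithm series\<close>

text \<open>Twice the artanh series: the even powers cancel in the difference.\<close>

lemma sums_ln_quotient:
  fixes z :: complex
  assumes "norm z < 1"
  shows "(\<lambda>j. 2 * (z ^ (2 * j + 1) / of_nat (2 * j + 1))) sums (ln (1 + z) - ln (1 - z))"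
proof -
  define f where "f k = (z ^ k - (- z) ^ k) / of_nat k" for k
  have "(\<lambda>k. - ((- z) ^ k) / of_nat k - (- (z ^ k) / of_nat k)) sums (ln (1 + z) - ln (1 - z))"
    using sums_diff[OF Ln_series'[OF assms] Ln_series'[of "- z"]] assms by simp
  then have "f sums (ln (1 + z) - ln (1 - z))"
    by (simp add: f_def [abs_def] diff_divide_distrib)
  moreover have "strict_mono (\<lambda>j :: nat. 2 * j + 1)"
    by (rule strict_monoI) simp
  moreover have "f k = 0" if "k \<notin> range (\<lambda>j. 2 * j + 1)" for k
  proof -
    have "even k" using that by (metis oddE rangeI)
    then show ?thesis by (simp add: f_def)
  qed
  ultimately have "(\<lambda>j. f (2 * j + 1)) sums (ln (1 + z) - ln (1 - z))"
    using sums_mono_reindex by blast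
  moreover have "f (2 * j + 1) = 2 * (z ^ (2 * j + 1) / of_nat (2 * j + 1))" for j
    by (simp add: f_def)
  ultimately show ?thesis by (simp only:)
qed

section \<open>Parseval's identity and the values of the power sums\<close>

context aurif_roots
begin

lemma psum_inverse: "(\<Sum>z\<in>S. inverse z ^ m) = psum m"
proof -
  have "psum m = (\<Sum>z\<in>inverse ` S. z ^ m)" by (simp add: psum_def image_inverse_S)
  also have "\<dots> = (\<Sum>z\<in>S. inverse z ^ m)" by (subst sum.reindex) (auto simp: inj_on_def)
  finally show ?thesis by simp
qed

text \<open>For \<open>x\<close> and \<open>z\<close> in \<open>S\<close>, summing
  \<open>(z / x)^m\<close> over the odd \<open>m\<close> below \<open>4n\<close> gives
  \<open>2n\<close> if \<open>x = z\<close> and 0 otherwise; the exceptional ratio \<open>-1\<close>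
  is excluded by \<open>neg_notin\<close>. As \<open>S\<close> is closed under inversion,
  \<open>p_m^2\<close> takes the role of the squared modulus.\<close>

lemma parseval: "(\<Sum>j<2 * n. (cpsum (2 * j + 1))\<^sup>2) = int (totient (4 * n))"
proof -
  have inner: "(\<Sum>j<2 * n. (z * inverse x) ^ (2 * j + 1)) = (if x = z then of_nat (2 * n) else 0)"
    if zx: "z \<in> S" "x \<in> S" for z x
  proof -
    define r where "r = z * inverse x"
    have x0: "x \<noteq> 0" using S_nonzero zx by blast
    have r: "r ^ (4 * n) = 1" "r \<noteq> - 1" "r = 1 \<longleftrightarrow> x = z"
    proof -
      show "r ^ (4 * n) = 1"
        using unity zx by (simp add: r_def power_mult_distrib power_inverse)
      show "r \<noteq> - 1"
      proof
        assume "r = - 1"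
        then have "z = - x" using x0 by (simp add: r_def field_simps)
        then show False using neg_notin zx by blast
      qed
      show "r = 1 \<longleftrightarrow> x = z" using x0 by (auto simp: r_def field_simps)
    qed
    have "(\<Sum>j<2 * n. r ^ (2 * j + 1)) = r * (\<Sum>j<2 * n. (r\<^sup>2) ^ j)"
      by (simp add: sum_distrib_left power_mult)
    also have "\<dots> = (if r = 1 then of_nat (2 * n) else 0)"
    proof (cases "r = 1")
      case False
      then have "r\<^sup>2 \<noteq> 1" using r(2) by (simp add: power2_eq_1_iff)
      moreover have "(r\<^sup>2) ^ (2 * n) = 1"
        using r(1) by (simp flip: power_mult)
      ultimately show ?thesis using False by (simp add: geometric_sum)
    qed simp
    finally show ?thesis using r(3) by (simp add: r_def)
  qed
  have "(\<Sum>j<2 * n. psum (2 * j + 1) * psum (2 * j + 1)) =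
      (\<Sum>j<2 * n. (\<Sum>z\<in>S. z ^ (2 * j + 1)) * (\<Sum>x\<in>S. inverse x ^ (2 * j + 1)))"
    by (simp only: psum_inverse) (simp only: psum_def)
  also have "\<dots> = (\<Sum>j<2 * n. \<Sum>z\<in>S. \<Sum>x\<in>S. (z * inverse x) ^ (2 * j + 1))"
    by (simp only: sum_product power_mult_distrib)
  also have "\<dots> = (\<Sum>z\<in>S. \<Sum>x\<in>S. \<Sum>j<2 * n. (z * inverse x) ^ (2 * j + 1))"
    by (subst sum.swap, intro sum.cong refl, rule sum.swap)
  also have "\<dots> = (\<Sum>z\<in>S. \<Sum>x\<in>S. if x = z then of_nat (2 * n) else 0)"
    by (intro sum.cong refl inner)
  also have "\<dots> = of_nat (n * (2 * card S))"
    using finite_S by simp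
  finally have "(\<Sum>j<2 * n. psum (2 * j + 1) * psum (2 * j + 1)) = of_nat (n * totient (4 * n))"
    using card_S by simp
  moreover have "psum (2 * j + 1) * psum (2 * j + 1) = of_int (int n * (cpsum (2 * j + 1))\<^sup>2)" for j
  proof -
    have "psum (2 * j + 1) * psum (2 * j + 1) = s\<^sup>2 * (of_int (cpsum (2 * j + 1)))\<^sup>2"
      by (subst (1 2) psum_odd) (simp_all add: power2_eq_square)
    then show ?thesis unfolding s_power2 by simp
  qed
  ultimately have "(of_int (int n * (\<Sum>j<2 * n. (cpsum (2 * j + 1))\<^sup>2)) :: complex) =
      of_int (int n * int (totient (4 * n)))"
    by (simp only: of_int_sum sum_distrib_left) simp
  then have "int n * (\<Sum>j<2 * n. (cpsum (2 * j + 1))\<^sup>2) = int n * int (totient (4 * n))"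
    by (simp only: of_int_eq_iff)
  then show ?thesis using n by simp
qed

lemma parseval': "(\<Sum>k\<in>{k. k < 4 * n \<and> odd k}. (cpsum k)\<^sup>2) = int (totient (4 * n))"
proof -
  have "{k. k < 4 * n \<and> odd k} = (\<lambda>j. 2 * j + 1) ` {..<2 * n}"
    by (auto elim!: oddE)
  moreover have "inj_on (\<lambda>j :: nat. 2 * j + 1) {..<2 * n}" by (simp add: inj_on_def)
  ultimately show ?thesis using parseval by (simp add: sum.reindex)
qed

lemma totatives_4n: "k \<in> totatives (4 * n) \<longleftrightarrow> k < 4 * n \<and> odd k \<and> coprime k n"
proof -
  have "coprime k (2 * 2 * n) \<longleftrightarrow> odd k \<and> coprime k n"
    unfolding coprime_mult_right_iff by auto
  then have "coprime k (4 * n) \<longleftrightarrow> odd k \<and> coprime k n" by simp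
  then show ?thesis
    using totatives_less[of k "4 * n"] n by (auto simp: in_totatives_iff intro: odd_pos)
qed

text \<open>With \<open>d = gcd m n\<close>, the products of \<open>m\<close> with the units modulo \<open>4 n\<close> hit each residue at most
  \<open>d\<close> times and leave \<open>\<bar>cpsum m\<bar>\<close>, a multiple of \<open>d\<close>, unchanged; were it nonzero, Parseval's
  sum would be too small.\<close>

lemma cpsum_eq_0:
  assumes m: "odd m" "\<not> coprime m n"
  shows "cpsum m = 0"
proof (rule ccontr)
  assume c: "cpsum m \<noteq> 0"
  define N where "N = 4 * n"
  define d where "d = gcd m n"
  define L where "L = N div d"
  let ?T = "totatives N" and ?K = "{k. k < N \<and> odd k}"
  have N0: "N > 0" and d0: "d > 0" using n by (auto simp: N_def d_def)
  have d1: "d > 1" using m(2) d0 unfolding d_def coprime_iff_gcd_eq_1 by linarith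
  have NL: "N = d * L" by (simp add: L_def N_def d_def)
  have L0: "L > 0" using N0 NL by (auto intro: Nat.gr0I)
  obtain m' where m': "m = d * m'" unfolding d_def by (meson dvdE gcd_dvd1)
  have "gcd m N = d"
  proof -
    have "coprime m (2 * 2)" using m(1) unfolding coprime_mult_right_iff by simp
    then have "gcd m (2 * 2 * n) = gcd m n" by (rule gcd_mult_right_left_cancel)
    then show ?thesis by (simp add: N_def d_def)
  qed
  then have cop: "coprime m' L"
    using div_gcd_coprime[of m N] N0 d0 by (simp add: L_def m')
  \<comment> \<open>The pair determines \<open>a\<close>: the residue of \<open>a * m\<close> fixes
    \<open>a\<close> modulo \<open>L\<close>, because \<open>m'\<close> is coprime to
    \<open>L\<close>, and \<open>a div L\<close> takes at most \<open>d\<close> values.\<close>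
  define f where "f a = (a * m mod N, a div L)" for a
  have inj: "inj_on f ?T"
  proof (rule inj_onI)
    fix a b assume "f a = f b"
    then have ab: "a * m mod N = b * m mod N" "a div L = b div L" by (auto simp: f_def)
    have "d * (a * m' mod L) = d * (b * m' mod L)"
      using ab(1) unfolding mult_mod_right NL m' by (simp only: mult.left_commute)
    then have "[a * m' = b * m'] (mod L)" using d0 by (simp add: cong_def)
    then have "[a = b] (mod L)" using cong_mult_rcancel_nat[OF cop] by blast
    then show "a = b" using ab(2) unfolding cong_def by (metis div_mult_mod_eq)
  qed
  have maps: "f ` ?T \<subseteq> ?K \<times> {..<d}"
  proof (clarsimp simp: f_def)
    fix a assume a: "a \<in> totatives N"
    then have "a < d * L" "odd a" unfolding NL[symmetric] by (auto simp: totatives_4n N_def)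
    then show "a * m mod N < N \<and> odd (a * m mod N) \<and> a div L < d"
      using N0 m(1) less_mult_imp_div_less by (auto simp: N_def dvd_mod_iff)
  qed
  have "int (totient N) * (cpsum m)\<^sup>2 = (\<Sum>a\<in>?T. (cpsum (fst (f a)))\<^sup>2)"
  proof -
    have "(cpsum (fst (f a)))\<^sup>2 = (cpsum m)\<^sup>2" if "a \<in> ?T" for a
    proof -
      have a: "a > 0" "odd a" "coprime a n"
        using that by (auto simp: totatives_4n N_def intro: odd_pos)
      have "cpsum (fst (f a)) = jacobi (int n) a * cpsum m"
        using cpsum_mod[of "a * m"] cpsum_mult[OF a m(1)] a m(1) by (simp add: f_def N_def)
      then show ?thesis using jacobi_cases[of a n] a by auto
    qed
    then show ?thesis by (simp add: totient_def)
  qed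
  also have "\<dots> = (\<Sum>x\<in>f ` ?T. (cpsum (fst x))\<^sup>2)"
    by (simp add: sum.reindex[OF inj])
  also have "\<dots> \<le> (\<Sum>x\<in>?K \<times> {..<d}. (cpsum (fst x))\<^sup>2)"
    by (rule sum_mono2) (use maps in auto)
  also have "\<dots> = int d * (\<Sum>k\<in>?K. (cpsum k)\<^sup>2)"
    by (simp add: sum.cartesian_product' sum_distrib_left)
  also have "\<dots> = int (totient N) * int d"
    using parseval' by (simp add: N_def)
  finally have "(cpsum m)\<^sup>2 \<le> int d" using N0 by simp
  \<comment> \<open>Now \<open>d^2 <= c^2 <= d\<close> for \<open>c = cpsum m\<close>, impossible
    for \<open>d > 1\<close>.\<close>
  moreover have "int d \<le> \<bar>cpsum m\<bar>"
    using gcd_dvd_cpsum[OF m(1)] c by (auto simp: d_def intro: zdvd_imp_le)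
  then have "(int d)\<^sup>2 \<le> (cpsum m)\<^sup>2" 
    using abs_le_square_iff[of "int d" "cpsum m"] by simp
  moreover have "int d * 1 < int d * int d"
    using d1 by (intro mult_strict_left_mono) auto
  ultimately show False by (simp add: power2_eq_square)
qed

text \<open>Only the \<open>totient (4 * n)\<close> units contribute to Parseval's sum, each with
  \<open>c_1^2\<close> as Jacobi symbols of units are signs, and the total is again
  \<open>totient (4 * n)\<close>.\<close>

lemma cpsum_1_power2: "(cpsum 1)\<^sup>2 = 1"
proof -
  let ?T = "totatives (4 * n)" and ?K = "{k. k < 4 * n \<and> odd k}"
  have "int (totient (4 * n)) = (\<Sum>k\<in>?K. (cpsum k)\<^sup>2)" by (simp add: parseval')
  also have "\<dots> = (\<Sum>k\<in>?T. (cpsum k)\<^sup>2)"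
    by (rule sum.mono_neutral_right) (auto simp: totatives_4n cpsum_eq_0)
  also have "\<dots> = (\<Sum>k\<in>?T. (cpsum 1)\<^sup>2)"
  proof (intro sum.cong refl)
    fix k assume "k \<in> ?T"
    then have k: "k > 0" "odd k" "coprime k n" by (auto simp: totatives_4n intro: odd_pos)
    show "(cpsum k)\<^sup>2 = (cpsum 1)\<^sup>2"
      using cpsum_mult[OF k, of 1] jacobi_cases[of k n] k by auto
  qed
  also have "\<dots> = int (totient (4 * n)) * (cpsum 1)\<^sup>2" by (simp add: totient_def)
  finally show ?thesis using n by simp
qed

lemma degree_A: "degree A = card S"
  by (simp add: A_prod degree_prod_sum_eq)

text \<open>\<open>S\<close> is closed under inversion, so \<open>A\<close> is palindromic; hence so is \<open>D\<close>, and its constant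
  coefficient is its leading one.\<close>

lemma coeff_D_0: "poly.coeff D 0 = 1"
proof -
  \<comment> \<open>The degree of \<open>A\<close> is even and positive, hence
    \<open>2 * k + 2\<close>; reversal exchanges the exponents 1 and \<open>2 * k + 1\<close>, which
    carry the coefficients 0 and \<open>k\<close> of \<open>D\<close>.\<close>
  define k where "k = (degree A - 1) div 2"
  have "totient (4 * n) > 0" using n by simp
  then have "card S > 0" using card_S by linarith
  then have deg: "degree A = 2 * k + 2"
    using card_S(2) unfolding k_def degree_A by (auto elim!: evenE)
  have "reflect_poly A = (\<Prod>z\<in>S. [:1, -z:])"
    unfolding A_prod reflect_poly_prod by (intro prod.cong refl) (simp add: reflect_poly_def cCons_def)
  then have "reflect_poly A = A" by (simp flip: A_prod')
  then have "poly.coeff A 1 = poly.coeff A (2 * k + 1)"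
    using coeff_reflect_poly[of A 1] by (simp add: deg)
  then have Dk: "poly.coeff D k = poly.coeff D 0"
    using s_nonzero by (simp add: coeff_A)
  have "cpsum 1 = - poly.coeff D 0"
    using psum_1 by (intro cpsum_eqI) auto
  \<comment> \<open>Nonzero since \<open>c_1^2 = 1\<close>; so \<open>k\<close> is the degree of
    \<open>D\<close> and the common value is its leading coefficient.\<close>
  then have "poly.coeff D k \<noteq> 0" using Dk cpsum_1_power2 by auto
  moreover have "poly.coeff D j = 0" if "j > k" for j
    using coeff_A[of "2 * j + 1"] coeff_eq_0[of A "2 * j + 1"] that deg s_nonzero by simp
  ultimately have "degree D = k"
    by (metis degree_le le_antisym le_degree)
  then show ?thesis using lead_D Dk by simp
qed

text \<open>Both sides vanish unless \<open>m\<close> is coprime to \<open>n\<close>; in that case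
  multiplicativity reduces the claim to \<open>c_1 = -1\<close>.\<close>

lemma psum_eq_jacobi:
  assumes m: "odd m"
  shows "psum m = - s * of_int (jacobi (int n) m)"
proof -
  have m0: "m > 0" using m by (rule odd_pos)
  have "cpsum m = - jacobi (int n) m"
  proof (cases "coprime m n")
    case True
    have "cpsum 1 = - 1" using psum_1 coeff_D_0 by (intro cpsum_eqI) auto
    then show ?thesis using cpsum_mult[OF m0 m True, of 1] by simp
  next
    case False
    then show ?thesis using cpsum_eq_0[OF m] jacobi_eq_0 m0 by (simp add: coprime_commute)
  qed
  then show ?thesis using psum_odd[OF m] by simp
qed

section \<open>The quotient formula on the unit disc\<close>

lemma poly_A_exp:
  assumes y: "norm y < 1"
  shows "poly A y = poly A (- y) * exp (2 * s * aurif_g n y)"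
proof -
  have small: "norm (z * y) < 1" if "z \<in> S" for z
    using norm_unity[OF unity[OF that]] n y by (simp add: norm_mult)
  \<comment> \<open>\<open>E\<close> is a logarithm of \<open>A(-y) / A(y)\<close>; exchanging the
    sums over roots and exponents turns it into a series in the power sums.\<close>
  define E where "E = (\<Sum>z\<in>S. ln (1 + z * y) - ln (1 - z * y))"
  have "(\<lambda>j. \<Sum>z\<in>S. 2 * ((z * y) ^ (2 * j + 1) / of_nat (2 * j + 1))) sums E"
    unfolding E_def by (intro sums_sum sums_ln_quotient small)
  also have "(\<lambda>j. \<Sum>z\<in>S. 2 * ((z * y) ^ (2 * j + 1) / of_nat (2 * j + 1))) =
    (\<lambda>j. psum (2 * j + 1) * (2 * (y ^ (2 * j + 1) / of_nat (2 * j + 1))))"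
    unfolding psum_def sum_distrib_right power_mult_distrib
    by (intro ext sum.cong refl) (simp only: mult_ac times_divide_eq_right)
  also have "\<dots> = (\<lambda>j. - 2 * s *
      (of_int (jacobi (int n) (2 * j + 1)) * (y ^ (2 * j + 1) / of_nat (2 * j + 1))))"
    by (subst psum_eq_jacobi) (simp_all add: mult_ac)
  finally have "(\<lambda>j. inverse (- 2 * s) * (- 2 * s *
      (of_int (jacobi (int n) (2 * j + 1)) * (y ^ (2 * j + 1) / of_nat (2 * j + 1))))) sums
      (inverse (- 2 * s) * E)"
    by (rule sums_mult)
  then have "(\<lambda>j. of_int (jacobi (int n) (2 * j + 1)) * (y ^ (2 * j + 1) / of_nat (2 * j + 1))) sums
      (inverse (- 2 * s) * E)"
    using s_nonzero by (simp add: field_simps)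
  then have "aurif_g n y = inverse (- 2 * s) * E"
    unfolding aurif_g_def by (rule sums_unique[symmetric])
  then have "2 * s * aurif_g n y = - E" using s_nonzero by (simp add: field_simps)
  also have "\<dots> = (\<Sum>z\<in>S. ln (1 - z * y) - ln (1 + z * y))"
    by (simp add: E_def flip: sum_negf)
  finally have "exp (2 * s * aurif_g n y) = (\<Prod>z\<in>S. exp (ln (1 - z * y) - ln (1 + z * y)))"
    using finite_S by (simp add: exp_sum)
  then have "poly A (- y) * exp (2 * s * aurif_g n y) =
      (\<Prod>z\<in>S. (1 + z * y) * exp (ln (1 - z * y) - ln (1 + z * y)))"
    by (simp add: A_prod' poly_prod mult.commute flip: prod.distrib)
  also have "\<dots> = (\<Prod>z\<in>S. 1 - z * y)"
  proof (intro prod.cong refl)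
    fix z assume "z \<in> S"
    then have "1 + z * y \<noteq> 0" "1 - z * y \<noteq> 0"
      using small[of z] by (auto simp: add_eq_0_iff)
    then show "(1 + z * y) * exp (ln (1 - z * y) - ln (1 + z * y)) = 1 - z * y"
      by (simp add: exp_diff)
  qed
  also have "\<dots> = poly A y"
    by (simp add: A_prod' poly_prod mult.commute)
  finally show ?thesis by simp
qed

end

section \<open>Cyclotomic factorisation\<close>

lemma pderiv_prod_linear_nonzero:
  fixes R :: "'a :: field set"
  assumes "finite R" "a \<in> R"
  shows "poly (pderiv (\<Prod>z\<in>R. [:-z, 1:])) a \<noteq> 0"
proof -
  have "(\<Prod>z\<in>R. [:-z, 1:]) = [:-a, 1:] * (\<Prod>z\<in>R - {a}. [:-z, 1:])"
    using assms by (simp add: prod.remove)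
  then have "poly (pderiv (\<Prod>z\<in>R. [:-z, 1:])) a = (\<Prod>z\<in>R - {a}. a - z)"
    by (simp only: pderiv_mult) (simp add: pderiv_pCons poly_prod)
  then show ?thesis using assms by simp
qed

definition primitive_roots :: "nat \<Rightarrow> complex set" where
  "primitive_roots m = (\<lambda>k. cis (2 * pi * real k / real m)) ` totatives m"

lemma inj_on_cis_totatives: "inj_on (\<lambda>k. cis (2 * pi * real k / real m)) (totatives m)"
proof (cases "m > 1")
  case True
  then have "totatives m \<subseteq> {..<m}" using totatives_less by auto
  moreover have "inj_on (\<lambda>k. cis (2 * pi * real k / real m)) {..<m}"
    using Complex.bij_betw_roots_unity[of m] True by (simp add: bij_betw_def)
  ultimately show ?thesis by (rule inj_on_subset[rotated])
next
  \<comment> \<open>Since \<open>totatives 1 = {1}\<close> is not contained in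
    \<open>{..<1}\<close>, this case is separate; there is at most one totative.\<close>
  case False
  then have "m = 0 \<or> m = 1" by linarith
  then show ?thesis by auto
qed

lemma cyclotomic_eq: "cyclotomic m = (\<Prod>z\<in>primitive_roots m. [:-z, 1:])"
  by (simp add: cyclotomic_def primitive_roots_def prod.reindex[OF inj_on_cis_totatives])

lemma finite_primitive_roots: "finite (primitive_roots m)"
  by (simp add: primitive_roots_def)

lemma poly_cyclotomic_eq_0: "poly (cyclotomic m) z = 0 \<longleftrightarrow> z \<in> primitive_roots m"
  using finite_primitive_roots by (auto simp: cyclotomic_eq poly_prod)

lemma degree_cyclotomic: "degree (cyclotomic m) = totient m"
  by (simp add: cyclotomic_def degree_prod_sum_eq totient_def)

lemma primitive_roots_unity:
  assumes "z \<in> primitive_roots m" shows "z ^ m = 1"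
proof -
  obtain k where k: "z = cis (2 * pi * real k / real m)" "k \<in> totatives m"
    using assms by (auto simp: primitive_roots_def)
  then have "m > 0" by (auto intro: Nat.gr0I)
  then have "z ^ m = cis (2 * pi) ^ k"
    unfolding k(1) by (simp add: Complex.DeMoivre mult_ac)
  then show ?thesis by simp
qed

lemma one_notin_primitive_roots: "m > 1 \<Longrightarrow> 1 \<notin> primitive_roots m"
proof
  assume m: "m > 1" and "1 \<in> primitive_roots m"
  then obtain k where k: "cis (2 * pi * real k / real m) = cis (2 * pi * real 0 / real m)" "k \<in> totatives m"
    by (auto simp: primitive_roots_def)
  then have "k < m" "k > 0" using totatives_less m by (auto simp: in_totatives_iff)
  moreover have "inj_on (\<lambda>k. cis (2 * pi * real k / real m)) {..<m}"
    using Complex.bij_betw_roots_unity[of m] m by (simp add: bij_betw_def)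
  ultimately have "k = 0"
    using inj_onD[of "\<lambda>k. cis (2 * pi * real k / real m)" "{..<m}" k 0] k(1) by simp
  then show False using \<open>k > 0\<close> by simp
qed

section \<open>The polynomial \<open>F_n(y^2)\<close>\<close>

text \<open>Brings both parities into the form \<open>\<delta> \<Phi>_m(c y^e)\<close>, with
  \<open>(m, e) = (n, 2)\<close> for odd \<open>n\<close> and \<open>(n / 2, 4)\<close> for even
  \<open>n\<close>, so that what follows needs no case distinction.\<close>

lemma aurif_F_square:
  assumes n: "n > 1" "squarefree n"
  obtains m e :: nat and \<delta> c :: complex
  where "aurif_F n \<circ>\<^sub>p [:0, 0, 1:] = Polynomial.smult \<delta> (cyclotomic m \<circ>\<^sub>p Polynomial.monom c e)"
    "\<delta> \<noteq> 0" "c \<noteq> 0" "e > 0" "totient m * e = totient (4 * n)" "4 dvd totient (4 * n)"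
    "\<And>y. c * y ^ e \<in> primitive_roots m \<Longrightarrow> y ^ (4 * n) = 1 \<and> y\<^sup>2 \<noteq> 1"
proof (cases "odd n")
  case True
  define c :: complex where "c = (if n mod 4 = 3 then - 1 else 1)"
  have c: "c ^ (2 * k) = 1" for k by (simp add: c_def)
  have "n > 2" using n True by (metis dvd_refl le_neq_implies_less Suc_1 Suc_leI One_nat_def)
  then have even: "even (totient n)" by (rule totient_even)
  have "coprime (2 * 2) n" using True unfolding coprime_mult_left_iff by simp
  then have tot: "totient n * 2 = totient (4 * n)"
    using totient_mult_coprime[of 4 n] by simp
  show thesis
  proof (rule that[of 1 n c 2])
    show "aurif_F n \<circ>\<^sub>p [:0, 0, 1:] = Polynomial.smult 1 (cyclotomic n \<circ>\<^sub>p Polynomial.monom c 2)"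
      unfolding poly_eq_poly_eq_iff [symmetric]
      by (rule ext) (use True in \<open>simp add: aurif_F_def c_def poly_pcompose poly_monom power2_eq_square mult_ac\<close>)
    show "4 dvd totient (4 * n)" using even unfolding tot[symmetric] by (auto elim!: evenE)
    fix y assume y: "c * y\<^sup>2 \<in> primitive_roots n"
    have "(c * y\<^sup>2) ^ n = 1" using y by (rule primitive_roots_unity)
    then have "((c * y\<^sup>2) ^ n)\<^sup>2 = 1" by simp
    then have "c ^ (2 * n) * y ^ (4 * n) = 1"
      by (simp add: power_mult_distrib mult.commute flip: power_mult)
    moreover have "y\<^sup>2 \<noteq> 1"
    proof
      assume "y\<^sup>2 = 1"
      \<comment> \<open>Here \<open>c = 1\<close> is not primitive as \<open>n > 1\<close>, and
        \<open>c = -1\<close> is no \<open>n\<close>-th root of unity as \<open>n\<close> is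
        odd.\<close>
      then have "c \<in> primitive_roots n" using y by simp
      then have "c ^ n = 1" "c \<noteq> 1" using primitive_roots_unity one_notin_primitive_roots n by auto
      then show False using True by (auto simp: c_def split: if_splits)
    qed
    ultimately show "y ^ (4 * n) = 1 \<and> y\<^sup>2 \<noteq> 1" by (simp only: c) simp
  qed (use tot in \<open>simp_all add: c_def\<close>)
next
  case False
  define m where "m = n div 2"
  have nm: "n = 2 * m" using False by (simp add: m_def)
  have "odd m"
  proof
    assume "even m"
    then have "2\<^sup>2 dvd n" by (auto simp: nm elim!: evenE)
    then have "(2 :: nat) dvd 1" by (rule squarefreeD[OF n(2)])
    then show False by simp
  qed
  then have "coprime (2 ^ 3) m" unfolding coprime_power_left_iff by simp
  moreover have "totient (2 ^ 3) = 4" by (subst totient_prime_power) simp_all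
  ultimately have tot: "totient m * 4 = totient (4 * n)"
    using totient_mult_coprime[of "2 ^ 3" m] by (simp add: nm)
  show thesis
  proof (rule that[of "(- 1) ^ totient m" m "- 1" 4])
    show "aurif_F n \<circ>\<^sub>p [:0, 0, 1:] =
        Polynomial.smult ((- 1) ^ totient m) (cyclotomic m \<circ>\<^sub>p Polynomial.monom (- 1) 4)"
      unfolding poly_eq_poly_eq_iff [symmetric]
      by (rule ext) (use False in \<open>simp add: aurif_F_def m_def poly_pcompose poly_monom power2_eq_square power4_eq_xxxx mult_ac\<close>)
    show "4 dvd totient (4 * n)" using tot by (metis dvd_triv_right)
    fix y :: complex assume y: "- 1 * y ^ 4 \<in> primitive_roots m"
    have *: "(- 1 * y ^ 4) ^ m = 1" using y by (rule primitive_roots_unity)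
    then have "((- 1 * y ^ 4) ^ m)\<^sup>2 = 1" by simp
    then have "y ^ (4 * n) = 1"
      by (simp add: power_mult_distrib nm mult.commute flip: power_mult)
    moreover have "y\<^sup>2 \<noteq> 1"
    proof
      assume "y\<^sup>2 = 1"
      then have "(y\<^sup>2)\<^sup>2 = 1" by simp
      then have "y ^ 4 = 1" by (simp flip: power_mult)
      then show False using * \<open>odd m\<close> by simp
    qed
    ultimately show "y ^ (4 * n) = 1 \<and> y\<^sup>2 \<noteq> 1" by blast
  qed (use tot in simp_all)
qed

text \<open>Simplicity of the roots follows from the chain rule: roots of \<open>\<Phi>_m\<close>
  are simple, and the inner monomial can be critical only at \<open>y = 0\<close>, which is not a
  root.\<close>

lemma aurif_F_facts:
  assumes n: "n > 1" "squarefree n"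
  shows degree_aurif_F: "2 * degree (aurif_F n) = totient (4 * n)" "even (degree (aurif_F n))"
    and aurif_F_root: "poly (aurif_F n) (y\<^sup>2) = 0 \<Longrightarrow> y ^ (4 * n) = 1 \<and> y\<^sup>2 \<noteq> 1"
    and rsquarefree_aurif_F: "rsquarefree (aurif_F n \<circ>\<^sub>p [:0, 0, 1:])"
proof -
  let ?H = "aurif_F n \<circ>\<^sub>p [:0, 0, 1:]"
  obtain m e \<delta> c where
    H: "?H = Polynomial.smult \<delta> (cyclotomic m \<circ>\<^sub>p Polynomial.monom c e)"
    and nz: "\<delta> \<noteq> 0" "c \<noteq> 0" "e > 0" and tot: "totient m * e = totient (4 * n)" "4 dvd totient (4 * n)"
    and roots: "\<And>y. c * y ^ e \<in> primitive_roots m \<Longrightarrow> y ^ (4 * n) = 1 \<and> y\<^sup>2 \<noteq> 1"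
    by (rule aurif_F_square[OF n], rule that)
  have poly_H: "poly ?H y = 0 \<longleftrightarrow> c * y ^ e \<in> primitive_roots m" for y
    using nz by (simp add: H poly_pcompose poly_monom poly_cyclotomic_eq_0)
  have "degree ?H = totient (4 * n)"
    unfolding H using nz tot by (simp add: degree_pcompose degree_cyclotomic degree_monom_eq)
  then show deg: "2 * degree (aurif_F n) = totient (4 * n)"
    by (simp add: degree_pcompose mult.commute)
  show "even (degree (aurif_F n))"
    using tot(2) unfolding deg[symmetric] by (auto elim!: dvdE)
  show "poly (aurif_F n) (y\<^sup>2) = 0 \<Longrightarrow> y ^ (4 * n) = 1 \<and> y\<^sup>2 \<noteq> 1"
    using poly_H[of y] roots[of y] by (simp add: poly_pcompose power2_eq_square)
  show "rsquarefree ?H"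
    unfolding rsquarefree_roots
  proof (intro allI notI, elim conjE)
    fix y assume y: "poly ?H y = 0" "poly (pderiv ?H) y = 0"
    have r: "c * y ^ e \<in> primitive_roots m" using y(1) poly_H by simp
    have "y \<noteq> 0" using roots[OF r] n by (auto simp: power_0_left)
    have "poly (pderiv (cyclotomic m)) (c * y ^ e) = 0"
      using y(2) nz \<open>y \<noteq> 0\<close>
      by (auto simp: H pderiv_smult pderiv_pcompose poly_pcompose poly_monom pderiv_monom)
    then show False
      using pderiv_prod_linear_nonzero[OF finite_primitive_roots r] by (simp add: cyclotomic_eq)
  qed
qed

text \<open>The roots come in pairs \<open>z, cnj z\<close> with product 1.\<close>

lemma prod_cnj_closed_circle:
  assumes fin: "finite S" and cnj: "\<And>z. z \<in> S \<Longrightarrow> cnj z \<in> S"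
    and norm: "\<And>z. z \<in> S \<Longrightarrow> norm z = 1" and nonreal: "\<And>z. z \<in> S \<Longrightarrow> Im z \<noteq> 0"
  shows "\<Prod>S = 1"
proof -
  let ?P = "{z \<in> S. Im z > 0}"
  have "S = ?P \<union> cnj ` ?P"
  proof (intro equalityI subsetI)
    fix z assume z: "z \<in> S"
    show "z \<in> ?P \<union> cnj ` ?P"
    proof (cases "Im z > 0")
      case False
      then have "cnj z \<in> ?P" using z cnj nonreal[OF z] by auto
      then show ?thesis by (metis UnI2 complex_cnj_cnj imageI)
    qed (use z in auto)
  qed (use cnj in auto)
  then have "\<Prod>S = \<Prod>(?P \<union> cnj ` ?P)" by simp
  also have "\<dots> = \<Prod>?P * \<Prod>(cnj ` ?P)"
    using fin by (intro prod.union_disjoint) auto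
  also have "\<Prod>(cnj ` ?P) = (\<Prod>z\<in>?P. cnj z)"
    by (subst prod.reindex) (auto simp: inj_on_def)
  also have "\<Prod>?P * (\<Prod>z\<in>?P. cnj z) = (\<Prod>z\<in>?P. z * cnj z)"
    by (simp add: prod.distrib)
  also have "\<dots> = 1"
    by (intro prod.neutral) (auto simp: complex_norm_square [symmetric] norm)
  finally show ?thesis .
qed

section \<open>From the defining identity to the hypotheses on the roots\<close>

lemma aurif_roots_aurif_poly:
  assumes n: "n > 1" "squarefree n"
    and monic: "lead_coeff C = 1" "lead_coeff D = 1"
    and CD: "aurif_F n =
      (map_poly of_int C)\<^sup>2 - of_nat n * [:0, 1:] * (map_poly of_int D)\<^sup>2"
  defines "A \<equiv> aurif_poly n C D"
  shows aurif_poly_factor: "poly (aurif_F n) (y\<^sup>2) = poly A y * poly A (- y)"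
    and "aurif_roots n C D A {z. poly A z = 0}"
proof -
  let ?S = "{z. poly A z = 0}" and ?H = "aurif_F n \<circ>\<^sub>p [:0, 0, 1:]"
  have s2: "of_real (sqrt n) * of_real (sqrt n) = (of_nat n :: complex)"
    by (simp flip: of_real_mult)
  show fact: "poly (aurif_F n) (y\<^sup>2) = poly A y * poly A (- y)" for y
  proof -
    let ?c = "poly (map_poly of_int C) (y\<^sup>2) :: complex" and ?d = "poly (map_poly of_int D) (y\<^sup>2) :: complex"
    have "poly A y * poly A (- y) = (?c + of_real (sqrt n) * y * ?d) * (?c - of_real (sqrt n) * y * ?d)"
      by (simp add: A_def poly_aurif_poly)
    also have "\<dots> = ?c\<^sup>2 - (of_real (sqrt n) * of_real (sqrt n)) * y\<^sup>2 * ?d\<^sup>2"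
      by (simp add: algebra_simps power2_eq_square)
    finally show ?thesis unfolding CD s2 by (simp add: poly_power mult_ac)
  qed
  have H: "?H = A * (A \<circ>\<^sub>p [:0, -1:])"
    unfolding poly_eq_poly_eq_iff [symmetric]
    by (rule ext) (use fact in \<open>simp add: poly_pcompose power2_eq_square\<close>)
  note sqfree = rsquarefree_aurif_F[OF n, unfolded rsquarefree_roots]
  have H0: "?H \<noteq> 0" using rsquarefree_aurif_F[OF n] by (auto simp: rsquarefree_def)
  have A0: "A \<noteq> 0" "A \<circ>\<^sub>p [:0, -1:] \<noteq> 0" using H H0 by auto
  have deg: "degree A = degree (aurif_F n)"
  proof -
    have "degree ?H = degree A + degree A"
      unfolding H using A0 by (simp add: degree_mult_eq degree_pcompose)
    then show ?thesis by (simp add: degree_pcompose)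
  qed
  then obtain h where h: "degree A = 2 * h"
    using degree_aurif_F(2)[OF n] by (auto elim!: evenE)
  \<comment> \<open>The degree \<open>2 * h\<close> is even, so the leading coefficient comes from
    \<open>C\<close>, whose degree is therefore \<open>h\<close>.\<close>
  have "lead_coeff A = 1"
  proof -
    have lead: "lead_coeff A = of_int (poly.coeff C h)"
      by (simp add: h) (simp add: A_def coeff_aurif_poly)
    moreover have "poly.coeff C j = 0" if "j > h" for j
      using coeff_eq_0[of A "2 * j"] that h coeff_aurif_poly[of n C D "2 * j"] by (simp add: A_def)
    moreover have "poly.coeff C h \<noteq> 0" using lead A0(1) by auto
    ultimately have "degree C = h" by (metis degree_le le_antisym le_degree)
    then show ?thesis using lead monic by simp
  qed
  moreover have "rsquarefree A"
    unfolding rsquarefree_roots using sqfree by (auto simp: H pderiv_mult)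
  ultimately have prod: "A = (\<Prod>z\<in>?S. [:-z, 1:])"
    using complex_poly_decompose_rsquarefree[of A] by simp
  have fin: "finite ?S" using A0(1) by (rule poly_roots_finite)
  have card: "card ?S = degree A"
    by (subst (2) prod) (simp add: degree_prod_sum_eq)
  have root: "z ^ (4 * n) = 1 \<and> z\<^sup>2 \<noteq> 1" if "z \<in> ?S" for z
    using that aurif_F_root[OF n, of z] fact by simp
  have norm: "norm z = 1" if "z \<in> ?S" for z
    using norm_unity[of z "4 * n"] root[OF that] n by simp
  have cnj: "cnj z \<in> ?S" if "z \<in> ?S" for z
  proof -
    have "poly.coeff A k \<in> \<real>" for k by (simp add: A_def coeff_aurif_poly)
    then have "cnj (poly A z) = poly A (cnj z)" by (rule poly_cnj_real)
    then show ?thesis using that by simp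
  qed
  have nonreal: "Im z \<noteq> 0" if "z \<in> ?S" for z
  proof
    assume "Im z = 0"
    then have "z = of_real (Re z)" "(norm z)\<^sup>2 = (Re z)\<^sup>2"
      by (simp_all add: complex_eq_iff cmod_power2)
    then have "z\<^sup>2 = of_real ((norm z)\<^sup>2)" by (metis of_real_power)
    then show False using root[OF that] norm[OF that] by simp
  qed
  show "aurif_roots n C D A ?S"
  proof
    show "poly A 0 = 1"
    proof -
      \<comment> \<open>The roots are nonreal and come in conjugate pairs on the unit circle, and
        their number is even.\<close>
      have "poly A 0 = (\<Prod>z\<in>?S. - z)" by (subst prod) (simp add: poly_prod)
      also have "\<dots> = (- 1) ^ card ?S * \<Prod>?S" by (simp add: prod_uminus)
      also have "\<dots> = 1" using prod_cnj_closed_circle[OF fin cnj norm nonreal] h by (simp add: card)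
      finally show ?thesis .
    qed
    show "- z \<notin> ?S" if "z \<in> ?S" for z
    proof
      \<comment> \<open>Then \<open>z\<close> is a root of both \<open>A(y)\<close> and
        \<open>A(-y)\<close>, a double root of their squarefree product.\<close>
      assume "- z \<in> ?S"
      with that have "poly ?H z = 0 \<and> poly (pderiv ?H) z = 0"
        by (simp add: H pderiv_mult pderiv_pcompose poly_pcompose)
      with sqfree show False by blast
    qed
    show "2 * card ?S = totient (4 * n)" "even (card ?S)"
      using degree_aurif_F[OF n] by (simp_all add: card deg)
  qed (use n monic prod fin root cnj in \<open>simp_all add: A_def\<close>)
qed

section \<open>Analytic continuation and the closed formulas\<close>

theorem theorem2:
  fixes n :: nat and C D :: "int poly" and U :: "complex set" and g R :: "complex \<Rightarrow> complex"
  assumes n: "n > 1" "squarefree n"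
    and monic: "lead_coeff C = 1" "lead_coeff D = 1"
    and CD: "aurif_F n =
      (map_poly of_int C)\<^sup>2 - of_nat n * [:0, 1:] * (map_poly of_int D)\<^sup>2"
    and U: "open U" "simply_connected U" "ball 0 1 \<subseteq> U"
      "\<And>y. y \<in> U \<Longrightarrow> poly (aurif_F n) (y\<^sup>2) \<noteq> 0"
    and g: "g holomorphic_on U" "\<And>y. norm y < 1 \<Longrightarrow> g y = aurif_g n y"
    and R: "R holomorphic_on U" "\<And>y. y \<in> U \<Longrightarrow> (R y)\<^sup>2 = poly (aurif_F n) (y\<^sup>2)" "R 0 = 1"
  shows "\<forall>y\<in>U.
      poly (map_poly of_int C) (y\<^sup>2) + of_real (sqrt n) * y * poly (map_poly of_int D) (y\<^sup>2)
        = R y * exp (of_real (sqrt n) * g y) \<and>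
      poly (map_poly of_int C) (y\<^sup>2) - of_real (sqrt n) * y * poly (map_poly of_int D) (y\<^sup>2)
        = R y * exp (- (of_real (sqrt n) * g y)) \<and>
      poly (map_poly of_int C) (y\<^sup>2) = R y * cosh (of_real (sqrt n) * g y) \<and>
      (y\<^sup>2 \<noteq> 0 \<longrightarrow>
        poly (map_poly of_int D) (y\<^sup>2)
          = R y / (of_real (sqrt n) * y) * sinh (of_real (sqrt n) * g y))"
proof -
  define A where "A = aurif_poly n C D"
  define s where "s = complex_of_real (sqrt n)"
  note fact = aurif_poly_factor[OF n monic CD, folded A_def]
  interpret aurif_roots n C D A "{z. poly A z = 0}"
    unfolding A_def by (rule aurif_roots_aurif_poly[OF n monic CD])
  have conn: "connected U"
    using U(2) by (simp add: simply_connected_imp_connected)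
  \<comment> \<open>The identity theorem extends the formula from the unit disc to
    \<open>U\<close>.\<close>
  have quot: "poly A y = poly A (- y) * exp (2 * s * g y)" if "y \<in> U" for y
  proof (rule analytic_continuation_open[where s = "ball 0 1" and s' = U
      and f = "poly A" and g = "\<lambda>y. poly A (- y) * exp (2 * s * g y)"])
    show "poly A holomorphic_on U" "(\<lambda>y. poly A (- y) * exp (2 * s * g y)) holomorphic_on U"
      using g(1) by (auto intro!: holomorphic_intros)
    show "poly A z = poly A (- z) * exp (2 * s * g z)" if "z \<in> ball 0 1" for z
      using that poly_A_exp[of z] g(2)[of z] by (simp add: s_def)
  qed (use U conn that in auto)
  have R0: "R y \<noteq> 0" if "y \<in> U" for y using R(2)[OF that] U(4)[OF that] by auto
  \<comment> \<open>\<open>L\<close> compares \<open>A\<close> with its claimed value. By the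
    factorisation and \<open>quot\<close> its square is 1; being continuous on the connected set
    \<open>U\<close>, it keeps its value 1 at 0. This settles the sign of the square root.\<close>
  define L where "L y = poly A y / (R y * exp (s * g y))" for y
  have L_range: "L y \<in> {1, - 1}" if y: "y \<in> U" for y
  proof -
    have "poly A y \<noteq> 0" "poly A (- y) \<noteq> 0" using U(4)[OF y] fact by auto
    have "(L y)\<^sup>2 = (poly A y)\<^sup>2 / (poly (aurif_F n) (y\<^sup>2) * (exp (s * g y))\<^sup>2)"
      by (simp add: L_def power_divide power_mult_distrib R(2)[OF y])
    also have "(exp (s * g y))\<^sup>2 = exp (2 * s * g y)"
      by (simp add: power2_eq_square mult.assoc flip: exp_add)
    also have "(poly A y)\<^sup>2 / (poly (aurif_F n) (y\<^sup>2) * exp (2 * s * g y)) =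
        (poly A y)\<^sup>2 / (poly A y * (poly A (- y) * exp (2 * s * g y)))"
      by (simp add: fact mult.assoc)
    also have "\<dots> = 1"
      unfolding quot[OF y, symmetric] using \<open>poly A y \<noteq> 0\<close> by (simp add: power2_eq_square)
    finally show ?thesis by (simp add: power2_eq_1_iff)
  qed
  have "continuous_on U L"
    unfolding L_def using R0 holomorphic_on_imp_continuous_on[OF g(1)] holomorphic_on_imp_continuous_on[OF R(1)]
    by (intro continuous_intros) auto
  moreover have "finite (L ` U)"
    by (rule finite_subset[of _ "{1, - 1}"]) (use L_range in auto)
  ultimately have "L constant_on U" by (intro continuous_finite_range_constant conn)
  moreover have "0 \<in> U" using U(3) by auto
  ultimately have L_const: "L y = L 0" if "y \<in> U" for y
    using that unfolding constant_on_def by metis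
  have "g 0 = 0" using g(2)[of 0] by (simp add: aurif_g_def)
  then have "L 0 = 1" by (simp add: L_def A_0 R(3))
  have plus: "poly A y = R y * exp (s * g y)" if y: "y \<in> U" for y
    using L_const[OF y] \<open>L 0 = 1\<close> R0[OF y] by (simp add: L_def)
  have minus: "poly A (- y) = R y * exp (- (s * g y))" if y: "y \<in> U" for y
  proof -
    have "exp (s * g y) = exp (2 * s * g y) * exp (- (s * g y))" by (simp add: mult.assoc flip: exp_add)
    then have "poly A (- y) * exp (2 * s * g y) = (R y * exp (- (s * g y))) * exp (2 * s * g y)"
      using quot[OF y] plus[OF y] by simp
    then show ?thesis by simp
  qed
  show ?thesis
  proof (intro ballI conjI impI)
    fix y assume y: "y \<in> U"
    let ?c = "poly (map_poly of_int C) (y\<^sup>2) :: complex" and ?d = "poly (map_poly of_int D) (y\<^sup>2) :: complex"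
    show 1: "?c + of_real (sqrt n) * y * ?d = R y * exp (of_real (sqrt n) * g y)"
      using plus[OF y] by (simp add: poly_A s_def)
    show 2: "?c - of_real (sqrt n) * y * ?d = R y * exp (- (of_real (sqrt n) * g y))"
      using minus[OF y] by (simp add: poly_A s_def)
    show "?c = R y * cosh (of_real (sqrt n) * g y)"
    proof -
      have "2 * ?c = R y * exp (of_real (sqrt n) * g y) + R y * exp (- (of_real (sqrt n) * g y))"
        unfolding 1[symmetric] 2[symmetric] by simp
      then show ?thesis by (simp add: cosh_field_def field_simps)
    qed
    assume "y\<^sup>2 \<noteq> 0"
    then have nz: "of_real (sqrt n) * y \<noteq> 0" using s_nonzero by simp
    have "2 * (of_real (sqrt n) * y * ?d) =
        R y * exp (of_real (sqrt n) * g y) - R y * exp (- (of_real (sqrt n) * g y))"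
      unfolding 1[symmetric] 2[symmetric] by simp
    then have "of_real (sqrt n) * y * ?d = R y * sinh (of_real (sqrt n) * g y)"
      by (simp add: sinh_field_def field_simps)
    then show "?d = R y / (of_real (sqrt n) * y) * sinh (of_real (sqrt n) * g y)"
      using nz by (simp add: divide_simps mult_ac)
  qed
qed

end
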